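(* Let $(s_n)_{n\ge 1}$ be the increasing enumeration of $S=\{2^j3^k : j,k\in\mathbb{Z}_{\ge 0}\}$ and let $W(S)$ be the set of $x\in\mathbb{T}=\mathbb{R}/\mathbb{Z}$ such that $(s_nx)_{n\ge1}$ is not equidistributed modulo $1$. Then: 1. There exists a probability measure $\mu$ on $\mathbb{T}$ with $\mu(W(S))=1$ and $\widehat\mu(h)=O\big(\frac{1}{\log\log h}\big)$ as $h\to\infty$. 2. For every $\alpha>1$, there is no probability measure $\mu$ on $\mathbb{T}$ with $\mu(W(S))=1$ and $\widehat\mu(h)=O\big(\frac{1}{(\log\log h)^{\alpha}}\big)$ as $h\to\infty$.
   Context: $\widehat\mu(h)=\int_{\mathbb{T}}e^{-2\pi i hx}\,d\mu(x)$ denotes the Fourier coefficient of $\mu$. *)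

theory Defs
  imports "HOL-Probability.Probability" "HOL-Library.Infinite_Set" "HOL-Library.Landau_Symbols"
begin

definition S23 :: "nat set" where
  "S23 = {2 ^ j * 3 ^ k | j k. True}"

lemma infinite_S23: "infinite S23"
proof -
  have "range (\<lambda>j. 2 ^ j :: nat) \<subseteq> S23"
    unfolding S23_def by (auto, metis mult.right_neutral power_0)
  moreover have "infinite (range (\<lambda>j. 2 ^ j :: nat))"
    by (intro range_inj_infinite injI) simp
  ultimately show ?thesis
    using finite_subset by blast
qed

text \<open>Sequences are indexed from 0, so \<open>s23 n\<close> is the usual $s_{n+1}$.\<close>

definition s23 :: "nat \<Rightarrow> nat" where
  "s23 = enumerate S23"

definition equidistributed_mod1 :: "(nat \<Rightarrow> real) \<Rightarrow> bool" where
  "equidistributed_mod1 u \<longleftrightarrow>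
     (\<forall>a b. 0 \<le> a \<longrightarrow> a < b \<longrightarrow> b \<le> 1 \<longrightarrow>
        (\<lambda>N. real (card {n. n < N \<and> frac (u n) \<in> {a..<b}}) / real N) \<longlonglongrightarrow> b - a)"

text \<open>
  The circle $\mathbb{R}/\mathbb{Z}$ is represented by its fundamental domain $[0,1)$. The
  Borel sets of the quotient correspond exactly to the Borel subsets of $[0,1)$, and both
  \<open>frac (s x)\<close> and $e^{-2\pi i h x}$, for integers $s$ and $h$, depend only on the class of $x$.
\<close>

definition torus :: "real set" where
  "torus = {0..<1}"

definition torus_prob_measure :: "real measure \<Rightarrow> bool" where
  "torus_prob_measure \<mu> \<longleftrightarrow> prob_space \<mu> \<and> sets \<mu> = sets (restrict_space borel torus)"

definition fourier_coeff :: "real measure \<Rightarrow> int \<Rightarrow> complex" where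
  "fourier_coeff \<mu> h = (LINT x|\<mu>. exp (- 2 * of_real pi * \<i> * of_int h * of_real x))"

definition W23 :: "real set" where
  "W23 = {x \<in> torus. \<not> equidistributed_mod1 (\<lambda>n. real (s23 n) * x)}"

end

theory Submission
  imports Defs "HOL-Real_Asymp.Real_Asymp"
begin

text \<open>
  If \<open>\<mu>\<close> has Fourier coefficients of order \<open>(ln ln h)\<^sup>-\<^sup>\<alpha>\<close>, expand the mean square of \<open>\<Sum>n<N. e(k s\<^sub>n x)\<close>
  into the coefficients at \<open>k (s\<^sub>n - s\<^sub>m)\<close>. Since \<open>s\<^sub>n\<close> grows like \<open>exp (c sqrt n)\<close>, for all but few pairs this
  frequency is at least \<open>exp (N\<^sup>c)\<close>, so the mean square is \<open>O(N\<^sup>2 (ln N)\<^sup>-\<^sup>\<alpha>)\<close>. For \<open>\<alpha> > 1\<close> the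
  Davenport--Erdos--LeVeque argument and Weyl's criterion give equidistribution almost everywhere.

  For the existence, put \<open>E\<^sub>t = 100\<^sup>t\<close> and \<open>q\<^sub>t = 2\<close> to the power \<open>E\<^sub>t\<close>, and take a weak limit of the densities obtained by
  multiplying successively, for \<open>i = 0, 1, 2, \<dots>\<close>, with the average over \<open>2\<^sup>i \<le> t < 2\<^sup>i\<^sup>+\<^sup>1\<close> of the Fejer
  kernels of \<open>q\<^sub>t x\<close>. At the \<open>i\<close>-th stage new coefficients are at most \<open>2\<^sup>-\<^sup>i\<close>, and occur only for
  \<open>ln ln h = O(2\<^sup>i)\<close>. Almost surely infinitely many \<open>t\<close> are such that \<open>q\<^sub>t m x\<close> is close to an integer for most
  small \<open>m\<close> in \<open>S\<close>; because most elements of \<open>S\<close> below a much higher power of 2 are multiples of \<open>q\<^sub>t\<close> by elements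
  of \<open>S\<close>, the sequence is then not equidistributed.
\<close>

section \<open>Trigonometric polynomials and Weyl's criterion\<close>

definition ee :: "int \<Rightarrow> real \<Rightarrow> complex" where
  "ee k x = cis (2 * pi * of_int k * x)"

lemma norm_ee [simp]: "norm (ee k x) = 1"
  by (simp add: ee_def)

lemma ee_0 [simp]: "ee 0 x = 1"
  by (simp add: ee_def)

lemma ee_mult: "ee j x * ee k x = ee (j + k) x"
  by (simp add: ee_def cis_mult algebra_simps)

lemma ee_scale: "ee j (of_int k * x) = ee (j * k) x"
  by (simp add: ee_def algebra_simps)

lemma cnj_ee: "cnj (ee k x) = ee (- k) x"
  by (simp add: ee_def cis_cnj)

lemma ee_frac: "ee k (frac x) = ee k x"
proof -
  have "ee k x = ee k (frac x) * cis (2 * pi * of_int (k * \<lfloor>x\<rfloor>))"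
    by (simp add: ee_def cis_mult frac_def algebra_simps)
  also have "cis (2 * pi * of_int (k * \<lfloor>x\<rfloor>)) = 1"
    by (rule cis_multiple_2pi) auto
  finally show ?thesis by simp
qed

lemma continuous_ee [continuous_intros]: "continuous_on A (ee k)"
  unfolding ee_def by (intro continuous_intros)

lemma borel_measurable_ee [measurable]: "ee k \<in> borel_measurable borel"
  by (intro borel_measurable_continuous_onI continuous_intros)

lemma fourier_coeff_eq: "fourier_coeff \<mu> h = (LINT x|\<mu>. ee (- h) x)"
  unfolding fourier_coeff_def ee_def by (simp add: cis_conv_exp algebra_simps)

text \<open>Trigonometric polynomials of degree at most \<open>D\<close>. Generation from monomials
  and sums lets linear identities be proved by checking characters only; the degree bound later
  decides which finite stage of the construction determines an integral.\<close>

inductive trig :: "int \<Rightarrow> (real \<Rightarrow> complex) \<Rightarrow> bool" for D where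
  monom: "\<bar>k\<bar> \<le> D \<Longrightarrow> trig D (\<lambda>x. c * ee k x)"
| add: "trig D f \<Longrightarrow> trig D g \<Longrightarrow> trig D (\<lambda>x. f x + g x)"

lemma trig_nonneg: "trig D f \<Longrightarrow> D \<ge> 0"
  by (induction rule: trig.induct) auto

lemma trig_const: "D \<ge> 0 \<Longrightarrow> trig D (\<lambda>_. c)"
  using trig.monom[of 0 D c] by simp

lemma trig_mono: "trig D f \<Longrightarrow> D \<le> D' \<Longrightarrow> trig D' f"
  by (induction rule: trig.induct) (auto intro: trig.intros)

lemma trig_mult_monom:
  "trig D f \<Longrightarrow> \<bar>k\<bar> \<le> D' \<Longrightarrow> trig (D + D') (\<lambda>x. f x * (c * ee k x))"
proof (induction rule: trig.induct)
  case (monom j d)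
  have "trig (D + D') (\<lambda>x. (d * c) * ee (j + k) x)"
    using monom by (intro trig.monom) auto
  moreover have "(d * ee j x) * (c * ee k x) = (d * c) * ee (j + k) x" for x
    by (simp only: ee_mult[symmetric] mult_ac)
  ultimately show ?case by (simp only:)
next
  case (add f g)
  then show ?case
    using trig.add by (simp add: distrib_right)
qed

lemma trig_mult: "trig D' g \<Longrightarrow> trig D f \<Longrightarrow> trig (D + D') (\<lambda>x. f x * g x)"
proof (induction rule: trig.induct)
  case (monom k c)
  then show ?case using trig_mult_monom by blast
next
  case (add f g)
  then show ?case using trig.add by (simp add: distrib_left)
qed

lemma trig_sum:
  assumes "D \<ge> 0" "\<And>i. i \<in> A \<Longrightarrow> trig D (f i)"
  shows "trig D (\<lambda>x. \<Sum>i\<in>A. f i x)"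
  using assms(2) by (induction A rule: infinite_finite_induct)
    (auto intro!: trig.add trig_const assms(1))

lemma trig_prod:
  assumes "finite A" "\<And>i. i \<in> A \<Longrightarrow> trig (D i) (f i)"
  shows "trig (\<Sum>i\<in>A. D i) (\<lambda>x. \<Prod>i\<in>A. f i x)"
  using assms
proof (induction A)
  case empty
  then show ?case using trig_const[of 0 1] by simp
next
  case (insert a A)
  have "trig (D a + (\<Sum>i\<in>A. D i)) (\<lambda>x. f a x * (\<Prod>i\<in>A. f i x))"
    using insert by (intro trig_mult) auto
  then show ?case using insert by simp
qed

lemma trig_cos: "\<bar>k\<bar> \<le> D \<Longrightarrow> trig D (\<lambda>x. of_real (1 - cos (2 * pi * of_int k * x)))"
proof -
  assume k: "\<bar>k\<bar> \<le> D"
  have "trig D (\<lambda>x. 1 + ((-1/2) * ee k x + (-1/2) * ee (- k) x))"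
    using k by (intro trig.add trig_const trig.monom) auto
  moreover have "1 + ((-1/2) * ee k x + (-1/2) * ee (- k) x) = of_real (1 - cos (2 * pi * of_int k * x))" for x
    by (simp add: ee_def complex_eq_iff)
  ultimately show ?thesis by simp
qed

text \<open>Transfers Stone-Weierstrass on the unit circle of the complex plane to approximation by
  characters.\<close>

lemma trig_real_polynomial:
  assumes "real_polynomial_function p"
  shows "\<exists>D. trig D (\<lambda>x. of_real (p (ee 1 x)))"
  using assms
proof (induction rule: real_polynomial_function.induct)
  case (linear f)
  interpret bounded_linear f by fact
  \<comment> \<open>A real-linear functional is fixed by its values at \<open>1\<close> and
    \<open>\<i>\<close>; the two coefficients come from writing cosine and sine through
    \<open>ee 1 x\<close> and \<open>ee (-1) x\<close>.\<close>
  have eq: "of_real (f (ee 1 x)) = ((f 1 - \<i> * f \<i>) / 2) * ee 1 x + ((f 1 + \<i> * f \<i>) / 2) * ee (-1) x" for x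
  proof -
    have "ee 1 x = cos (2 * pi * x) *\<^sub>R 1 + sin (2 * pi * x) *\<^sub>R \<i>"
      by (simp add: ee_def complex_eq_iff)
    then have "f (ee 1 x) = cos (2 * pi * x) * f 1 + sin (2 * pi * x) * f \<i>"
      by (simp only: add scale real_scaleR_def)
    then show ?thesis by (simp add: ee_def complex_eq_iff field_simps)
  qed
  show ?case unfolding eq
    by (intro exI[of _ 1] trig.add trig.monom) auto
next
  case (const c)
  then show ?case using trig_const[of 0] by auto
next
  case (add f g)
  then obtain D D' where "trig D (\<lambda>x. of_real (f (ee 1 x)))" "trig D' (\<lambda>x. of_real (g (ee 1 x)))"
    by auto
  then have "trig (max D D') (\<lambda>x. of_real (f (ee 1 x)) + of_real (g (ee 1 x)))"
    by (intro trig.add) (auto elim: trig_mono)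
  then show ?case by auto
next
  case (mult f g)
  then show ?case by simp (metis trig_mult)
qed

section \<open>Lebesgue measure on the circle, carried by [0,1] inside the real line\<close>

definition U :: "real measure" where "U = uniform_measure lborel {0..1}"

lemma sets_U [simp, measurable_cong]: "sets U = sets borel"
  by (simp add: U_def)

lemma space_U [simp]: "space U = UNIV"
  by (simp add: U_def)

lemma prob_space_U: "prob_space U"
  unfolding U_def by (rule prob_space_uniform_measure) auto

lemma emeasure_U: "A \<in> sets borel \<Longrightarrow> emeasure U A = emeasure lborel ({0..1} \<inter> A)"
  unfolding U_def by (subst emeasure_uniform_measure) (auto simp: divide_ennreal_def)

lemma integral_U:
  fixes f :: "real \<Rightarrow> 'a::{banach, second_countable_topology}"
  assumes [measurable]: "f \<in> borel_measurable borel"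
  shows "integral\<^sup>L U f = (LINT x|lborel. indicator {0..1} x *\<^sub>R f x)"
proof -
  have eq: "U = density lborel (\<lambda>x. ennreal (indicator {0..1} x))"
    unfolding U_def uniform_measure_def by (simp add: ennreal_indicator divide_ennreal_def)
  show ?thesis unfolding eq by (subst integral_density) auto
qed

lemma integral_ee: "integral\<^sup>L U (ee k) = (if k = 0 then 1 else 0)"
proof (cases "k = 0")
  case True
  have "integral\<^sup>L U (ee 0) = (LINT x|U. 1)" by (rule Bochner_Integration.integral_cong) auto
  also have "\<dots> = 1" using prob_space.prob_space[OF prob_space_U] by simp
  finally show ?thesis using True by simp
next
  case False
  define c :: complex where "c = \<i> * 2 * pi * of_int k"
  have c: "c \<noteq> 0" using False by (simp add: c_def)
  have ee: "ee k x = exp (c * x)" for x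
    by (simp add: ee_def cis_conv_exp c_def algebra_simps)
  have "((\<lambda>x. exp (c * of_real x) / c) has_vector_derivative exp (c * of_real x)) (at x within {0..1})" for x :: real
    using c by (auto intro!: derivative_eq_intros has_vector_derivative_real_field simp: field_simps)
  then have "(LINT x|lborel. indicator {0..1} x *\<^sub>R ee k x) = exp (c * of_real 1) / c - exp (c * of_real 0) / c"
    unfolding ee by (intro integral_FTC_Icc) (auto intro!: continuous_intros)
  also have "exp (c * of_real 1) = ee k 1" by (simp add: ee)
  also have "ee k 1 = 1" using cis_multiple_2pi[of "of_int k"] by (simp add: ee_def)
  finally show ?thesis using False by (simp add: integral_U)
qed

lemma trig_borel: "trig D f \<Longrightarrow> f \<in> borel_measurable borel"
  by (induction rule: trig.induct) auto

lemma trig_bounded: "trig D f \<Longrightarrow> \<exists>B. \<forall>x. norm (f x) \<le> B"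
proof (induction rule: trig.induct)
  case (monom k c)
  then show ?case by (auto simp: norm_mult)
next
  case (add f g)
  then obtain B B' where "\<forall>x. norm (f x) \<le> B" "\<forall>x. norm (g x) \<le> B'" by auto
  then have "\<forall>x. norm (f x + g x) \<le> B + B'" by (meson norm_triangle_mono)
  then show ?case by blast
qed

lemma trig_integrable:
  assumes "trig D f" "prob_space M" "sets M = sets borel"
  shows "integrable M f"
proof -
  obtain B where B: "\<forall>x. norm (f x) \<le> B" using trig_bounded assms(1) by blast
  interpret prob_space M by fact
  have "f \<in> borel_measurable M"
    using trig_borel[OF assms(1)] assms(3) by (simp add: measurable_def sets_eq_imp_space_eq)
  then show ?thesis using B by (intro integrable_const_bound[of _ B]) auto
qed

section \<open>Counting frequencies and Weyl's criterion\<close>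

abbreviation freq :: "(nat \<Rightarrow> real) \<Rightarrow> real \<Rightarrow> real \<Rightarrow> nat \<Rightarrow> real" where
  "freq u a b N \<equiv> real (card {n. n < N \<and> frac (u n) \<in> {a..<b}}) / real N"

lemma freq_split:
  assumes ab: "0 \<le> a" "a \<le> b" "b \<le> 1" and N: "N > 0"
  shows "freq u 0 a N + freq u a b N + freq u b 1 N = 1"
proof -
  let ?A = "\<lambda>a b. {n. n < N \<and> frac (u n) \<in> {a..<b}}"
  have "{..<N} = ?A 0 a \<union> ?A a b \<union> ?A b 1"
    using frac_lt_1 frac_ge_0 by force
  then have "N = card (?A 0 a \<union> ?A a b \<union> ?A b 1)"
    by (metis card_lessThan)
  also have "\<dots> = card (?A 0 a \<union> ?A a b) + card (?A b 1)"
    by (rule card_Un_disjoint) (use ab in auto)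
  also have "card (?A 0 a \<union> ?A a b) = card (?A 0 a) + card (?A a b)"
    by (rule card_Un_disjoint) (use ab in auto)
  finally have "real N = real (card (?A 0 a)) + real (card (?A a b)) + real (card (?A b 1))"
    by linarith
  then show ?thesis using N by (simp add: add_divide_distrib[symmetric])
qed

text \<open>An asymptotic upper bound for all intervals suffices: the lower bound for \<open>[a, b)\<close> comes from the
  upper bounds for \<open>[0, a)\<close> and \<open>[b, 1)\<close>.\<close>

lemma equidistributed_mod1I:
  assumes upper: "\<And>a b e. 0 \<le> a \<Longrightarrow> a \<le> b \<Longrightarrow> b \<le> 1 \<Longrightarrow> e > 0
    \<Longrightarrow> eventually (\<lambda>N. freq u a b N \<le> b - a + e) sequentially"
  shows "equidistributed_mod1 u"
  unfolding equidistributed_mod1_def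
proof (intro allI impI)
  fix a b :: real assume ab: "0 \<le> a" "a < b" "b \<le> 1"
  show "freq u a b \<longlonglongrightarrow> b - a"
  proof (rule LIMSEQ_I)
    fix e :: real assume e: "e > 0"
    have "eventually (\<lambda>N. N > 0 \<and> freq u 0 a N \<le> a - 0 + e / 3 \<and> freq u a b N \<le> b - a + e / 3
        \<and> freq u b 1 N \<le> 1 - b + e / 3) sequentially"
      using ab e by (intro eventually_conj upper eventually_gt_at_top) auto
    then have "eventually (\<lambda>N. norm (freq u a b N - (b - a)) < e) sequentially"
    proof eventually_elim
      case (elim N)
      with freq_split[of a b N u] ab e show ?case by (simp add: abs_if)
    qed
    then show "\<exists>no. \<forall>N\<ge>no. norm (freq u a b N - (b - a)) < e"
      by (simp add: eventually_sequentially)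
  qed
qed

text \<open>Weyl's hypothesis on one sequence. Means converge first for trigonometric polynomials,
  then for continuous functions on the circle; indicators of arcs are reached only from above, which
  is all that \<open>equidistributed_mod1I\<close> asks for.\<close>

locale weyl_sums =
  fixes u :: "nat \<Rightarrow> real"
  assumes weyl: "\<And>k. k \<noteq> 0 \<Longrightarrow> (\<lambda>N. (\<Sum>n<N. ee k (u n)) / of_nat N) \<longlonglongrightarrow> 0"
begin

lemma mean_trig:
  assumes "trig D f"
  shows "(\<lambda>N. (\<Sum>n<N. f (u n)) / of_nat N) \<longlonglongrightarrow> integral\<^sup>L U f"
  using assms
proof (induction rule: trig.induct)
  case (monom k c)
  have "(\<lambda>N. (\<Sum>n<N. ee k (u n)) / of_nat N) \<longlonglongrightarrow> integral\<^sup>L U (ee k)"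
  proof (cases "k = 0")
    case True
    have "eventually (\<lambda>N. (1::complex) = (\<Sum>n<N. ee k (u n)) / of_nat N) sequentially"
      using eventually_gt_at_top[of 0] by eventually_elim (use True in auto)
    then have "(\<lambda>N. (\<Sum>n<N. ee k (u n)) / of_nat N) \<longlonglongrightarrow> 1"
      by (rule Lim_transform_eventually[OF tendsto_const])
    then show ?thesis using True by (simp add: integral_ee)
  qed (use weyl in \<open>auto simp: integral_ee\<close>)
  from tendsto_mult_left[OF this, of c] show ?case
    by (simp add: sum_distrib_left)
next
  case (add f g)
  from tendsto_add[OF add.IH] show ?case
    using add.hyps trig_integrable[OF _ prob_space_U sets_U]
    by (simp add: sum.distrib add_divide_distrib)
qed

text \<open>A real polynomial within \<open>e / 4\<close> of \<open>g\<close> on the circle alters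
  both the mean and the integral by at most \<open>e / 4\<close>; a third \<open>e / 4\<close>
  covers the convergence of the means of the polynomial.\<close>

lemma mean_continuous:
  assumes g: "continuous_on (sphere 0 1) (g :: complex \<Rightarrow> real)"
  shows "(\<lambda>N. (\<Sum>n<N. g (ee 1 (u n))) / of_nat N) \<longlonglongrightarrow> (LINT x|U. g (ee 1 x))"
proof (rule LIMSEQ_I)
  fix e :: real assume e: "e > 0"
  obtain p where p: "real_polynomial_function p" "\<And>x. x \<in> sphere 0 1 \<Longrightarrow> \<bar>g x - p x\<bar> < e / 4"
    using Stone_Weierstrass_real_polynomial_function[OF _ g, of "e/4"] e by auto
  then have gp: "\<bar>g (ee 1 x) - p (ee 1 x)\<bar> < e / 4" for x by auto
  obtain D where D: "trig D (\<lambda>x. of_real (p (ee 1 x)))" using trig_real_polynomial p by blast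
  have intp: "integrable U (\<lambda>x. p (ee 1 x))"
    using trig_integrable[OF D prob_space_U sets_U] using integrable_Re by fastforce
  have "(\<lambda>N. of_real ((\<Sum>n<N. p (ee 1 (u n))) / of_nat N) :: complex)
      \<longlonglongrightarrow> of_real (LINT x|U. p (ee 1 x))"
    using mean_trig[OF D] by simp
  then have "(\<lambda>N. (\<Sum>n<N. p (ee 1 (u n))) / of_nat N) \<longlonglongrightarrow> (LINT x|U. p (ee 1 x))"
    by (simp only: tendsto_of_real_iff)
  from LIMSEQ_D[OF this, of "e/4"] e obtain N0 where
    N0: "\<And>N. N \<ge> N0 \<Longrightarrow> \<bar>(\<Sum>n<N. p (ee 1 (u n))) / of_nat N - (LINT x|U. p (ee 1 x))\<bar> < e / 4"
    by auto
  interpret U: prob_space U by (rule prob_space_U)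
  have cont: "continuous_on UNIV (\<lambda>x. g (ee 1 x))"
    by (intro continuous_on_compose2[OF g] continuous_intros) auto
  have gm: "(\<lambda>x. g (ee 1 x)) \<in> borel_measurable U"
    using borel_measurable_continuous_onI[OF cont] by (simp add: measurable_def)
  have "bounded (g ` sphere 0 1)"
    by (intro compact_imp_bounded compact_continuous_image g) auto
  then obtain B where B: "\<And>z. z \<in> sphere 0 1 \<Longrightarrow> \<bar>g z\<bar> \<le> B" unfolding bounded_iff by (metis imageI real_norm_def)
  have intg: "integrable U (\<lambda>x. g (ee 1 x))"
    by (rule U.integrable_const_bound[of _ B]) (use B gm in auto)
  have "\<bar>(LINT x|U. g (ee 1 x)) - (LINT x|U. p (ee 1 x))\<bar> = \<bar>LINT x|U. g (ee 1 x) - p (ee 1 x)\<bar>"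
    using intp intg by simp
  also have "\<dots> \<le> (LINT x|U. \<bar>g (ee 1 x) - p (ee 1 x)\<bar>)" by (rule integral_abs_bound)
  also have "\<dots> \<le> (LINT x|U. e / 4)"
    using intp intg gp by (intro integral_mono) (auto intro: less_imp_le)
  also have "\<dots> = e / 4" by (simp add: U.prob_space[simplified])
  finally have 1: "\<bar>(LINT x|U. g (ee 1 x)) - (LINT x|U. p (ee 1 x))\<bar> \<le> e / 4" .
  have 2: "\<bar>(\<Sum>n<N. g (ee 1 (u n))) / of_nat N - (\<Sum>n<N. p (ee 1 (u n))) / of_nat N\<bar> \<le> e / 4" for N
  proof (cases "N = 0")
    case False
    have "\<bar>\<Sum>n<N. g (ee 1 (u n)) - p (ee 1 (u n))\<bar> \<le> (\<Sum>n<N. e / 4)"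
      using gp by (intro order.trans[OF sum_abs] sum_mono) (auto intro: less_imp_le)
    then show ?thesis using False
      by (simp add: sum_subtractf diff_divide_distrib[symmetric] field_simps)
  qed (use e in auto)
  show "\<exists>no. \<forall>n\<ge>no. norm ((\<Sum>n<n. g (ee 1 (u n))) / real n - (LINT x|U. g (ee 1 x))) < e"
  proof (intro exI[of _ N0] allI impI)
    fix N assume "N \<ge> N0"
    from N0[OF this] 1 2[of N] e show "norm ((\<Sum>n<N. g (ee 1 (u n))) / real N - (LINT x|U. g (ee 1 x))) < e"
      unfolding real_norm_def by linarith
  qed
qed

lemma freq_upper:
  assumes ab: "0 \<le> a" "a \<le> b" "b \<le> 1" and e: "e > 0"
  shows "eventually (\<lambda>N. freq u a b N \<le> b - a + e) sequentially"
proof -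
  \<comment> \<open>The arc is closed, so the continuous functions \<open>\<phi> j\<close>, equal to
    1 on it, decrease to its indicator; dominated convergence then finds one whose integral is below
    \<open>b - a + e / 2\<close>.\<close>
  define arc where "arc = ee 1 ` {a..b}"
  have arc: "compact arc" "arc \<noteq> {}"
    unfolding arc_def using ab by (auto intro!: compact_continuous_image continuous_intros)
  define \<phi> where "\<phi> j z = max 0 (1 - real j * infdist z arc)" for j :: nat and z
  have \<phi>_cont: "continuous_on A (\<phi> j)" for A j
    unfolding \<phi>_def by (intro continuous_intros)
  have \<phi>_bound: "0 \<le> \<phi> j z" "\<phi> j z \<le> 1" for j z
    unfolding \<phi>_def by (auto simp: infdist_nonneg)
  have \<phi>_arc: "\<phi> j z = 1" if "z \<in> arc" for j z
    using that by (simp add: \<phi>_def)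
  have \<phi>_lim: "(\<lambda>j. \<phi> j z) \<longlonglongrightarrow> indicator arc z" for z
  proof (cases "z \<in> arc")
    case False
    then have pos: "infdist z arc > 0"
      using arc infdist_pos_not_in_closed[of arc z] compact_imp_closed by auto
    obtain j0 :: nat where j0: "real j0 * infdist z arc > 1"
      using reals_Archimedean3[OF pos] by blast
    have "\<phi> j z = 0" if "j \<ge> j0" for j
    proof -
      have "real j0 * infdist z arc \<le> real j * infdist z arc"
        using that pos by (intro mult_right_mono) auto
      then show ?thesis using j0 by (simp add: \<phi>_def)
    qed
    then have "eventually (\<lambda>j. 0 = \<phi> j z) sequentially"
      using eventually_mono[OF eventually_ge_at_top[of j0]] by force
    then have "(\<lambda>j. \<phi> j z) \<longlonglongrightarrow> 0" by (rule Lim_transform_eventually[OF tendsto_const])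
    then show ?thesis using False by simp
  qed (simp add: \<phi>_arc)
  interpret U: prob_space U by (rule prob_space_U)
  have [measurable]: "arc \<in> sets borel" using compact_imp_closed[OF arc(1)] by (rule borel_closed)
  have [measurable]: "\<phi> j \<in> borel_measurable borel" for j
    by (intro borel_measurable_continuous_onI \<phi>_cont)
  have "(\<lambda>j. LINT x|U. \<phi> j (ee 1 x)) \<longlonglongrightarrow> (LINT x|U. indicator arc (ee 1 x))"
  proof (rule integral_dominated_convergence[of _ _ _ "\<lambda>_. 1"])
    show "AE x in U. (\<lambda>i. \<phi> i (ee 1 x)) \<longlonglongrightarrow> indicator arc (ee 1 x)" using \<phi>_lim by auto
    show "AE x in U. norm (\<phi> i (ee 1 x)) \<le> 1" for i using \<phi>_bound by auto
  qed auto
  moreover have "(LINT x|U. indicator arc (ee 1 x)) = (LINT x|U. indicator (ee 1 -` arc) x :: real)"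
    by (intro Bochner_Integration.integral_cong) (auto simp: indicator_def)
  moreover have "\<dots> = measure U (ee 1 -` arc)"
    by (subst Bochner_Integration.integral_indicator) auto
  ultimately have lim: "(\<lambda>j. LINT x|U. \<phi> j (ee 1 x)) \<longlonglongrightarrow> measure U (ee 1 -` arc)"
    by simp
  \<comment> \<open>The preimage of the arc is periodic. Everything outside [0,1] is null for
    \<open>U\<close>, and the points 0 and 1 are added because they are identified on the circle;
    inside the open interval the preimage is contained in \<open>{a..b}\<close>.\<close>
  have "measure U (ee 1 -` arc) \<le> measure U ({a..b} \<union> {0,1} \<union> {x. x < 0} \<union> {x. x > 1})"
  proof (rule U.finite_measure_mono)
    show "ee 1 -` arc \<subseteq> {a..b} \<union> {0,1} \<union> {x. x < 0} \<union> {x. x > 1}"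
    proof
      fix x assume "x \<in> ee 1 -` arc"
      then obtain y where y: "y \<in> {a..b}" "ee 1 x = ee 1 y" unfolding arc_def by auto
      then have "ee 1 (x - y) = 1"
        by (simp add: ee_def right_diff_distrib cis_divide[symmetric])
      then have "cos (2 * pi * (x - y)) = 1"
        by (simp add: ee_def complex_eq_iff)
      then obtain n :: int where "2 * pi * (x - y) = of_int n * 2 * pi"
        unfolding cos_one_2pi_int by auto
      then have n: "x - y = of_int n" by simp
      show "x \<in> {a..b} \<union> {0,1} \<union> {x. x < 0} \<union> {x. x > 1}"
      proof (cases "0 < x \<and> x < 1")
        case True
        then have "\<bar>real_of_int n\<bar> < 1" using y ab n by auto
        then have "n = 0" by linarith
        then show ?thesis using n y by auto
      qed auto
    qed
  qed auto
  also have "\<dots> = b - a"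
  proof -
    have "emeasure U ({a..b} \<union> {0,1} \<union> {x. x < 0} \<union> {x. x > 1}) =
        emeasure lborel ({0..1} \<inter> ({a..b} \<union> {0,1} \<union> {x. x < 0} \<union> {x. x > 1}))"
      by (rule emeasure_U) auto
    also have "{0..1} \<inter> ({a..b} \<union> {0,1} \<union> {x. x < 0} \<union> {x. x > 1}) = {a..b} \<union> {0,1}"
      using ab by auto
    also have "emeasure lborel ({a..b} \<union> {0,1}) = emeasure lborel {a..b}"
      by (rule emeasure_Un_null_set) (auto intro!: finite_imp_null_set_lborel)
    finally show ?thesis using ab by (simp add: measure_def)
  qed
  finally have "measure U (ee 1 -` arc) < b - a + e / 2" using e by simp
  with order_tendstoD(2)[OF lim] have "eventually (\<lambda>j. (LINT x|U. \<phi> j (ee 1 x)) < b - a + e / 2) sequentially"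
    by simp
  then obtain j where j: "(LINT x|U. \<phi> j (ee 1 x)) < b - a + e / 2"
    by (meson eventually_happens sequentially_bot)
  have "(\<lambda>N. (\<Sum>n<N. \<phi> j (ee 1 (u n))) / real N) \<longlonglongrightarrow> (LINT x|U. \<phi> j (ee 1 x))"
    by (rule mean_continuous[OF \<phi>_cont])
  from order_tendstoD(2)[OF this, of "b - a + e"] j e
  have "eventually (\<lambda>N. (\<Sum>n<N. \<phi> j (ee 1 (u n))) / real N < b - a + e) sequentially"
    by simp
  then show ?thesis
  proof eventually_elim
    case (elim N)
    have "real (card {n. n < N \<and> frac (u n) \<in> {a..<b}}) = (\<Sum>n | n < N \<and> frac (u n) \<in> {a..<b}. 1)"
      by simp
    also have "\<dots> \<le> (\<Sum>n | n < N \<and> frac (u n) \<in> {a..<b}. \<phi> j (ee 1 (u n)))"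
    proof (rule sum_mono)
      fix n assume "n \<in> {n. n < N \<and> frac (u n) \<in> {a..<b}}"
      then have "ee 1 (frac (u n)) \<in> arc" unfolding arc_def by auto
      then show "1 \<le> \<phi> j (ee 1 (u n))" using \<phi>_arc by (simp add: ee_frac)
    qed
    also have "\<dots> \<le> (\<Sum>n<N. \<phi> j (ee 1 (u n)))"
      by (rule sum_mono2) (use \<phi>_bound in auto)
    finally have "freq u a b N \<le> (\<Sum>n<N. \<phi> j (ee 1 (u n))) / real N"
      by (intro divide_right_mono) auto
    with elim show ?case by simp
  qed
qed

theorem equidistributed: "equidistributed_mod1 u"
  by (rule equidistributed_mod1I) (rule freq_upper)

end

section \<open>Mean squares of exponential sums\<close>

text \<open>For \<open>N\<close> between \<open>q j\<close> and \<open>q (Suc j)\<close> the extra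
  terms number at most \<open>q (Suc j) - q j\<close>, which is \<open>o(q j)\<close> by the ratio
  hypothesis.\<close>

lemma mean_interpolate:
  fixes z :: "nat \<Rightarrow> complex" and q :: "nat \<Rightarrow> nat"
  assumes z: "\<And>n. norm (z n) \<le> 1"
    and q: "mono q" "filterlim q at_top sequentially" "\<And>j. q j > 0"
    and ratio: "(\<lambda>j. real (q (Suc j)) / real (q j)) \<longlonglongrightarrow> 1"
    and lim: "(\<lambda>j. norm (\<Sum>n<q j. z n) / real (q j)) \<longlonglongrightarrow> 0"
  shows "(\<lambda>N. (\<Sum>n<N. z n) / of_nat N) \<longlonglongrightarrow> 0"
proof (rule LIMSEQ_I)
  fix e :: real assume e: "e > 0"
  have "eventually (\<lambda>j. norm (\<Sum>n<q j. z n) / real (q j) < e / 2 \<and> real (q (Suc j)) / real (q j) < 1 + e / 2) sequentially"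
    by (intro eventually_conj order_tendstoD(2)[OF lim] order_tendstoD(2)[OF ratio]) (use e in auto)
  then obtain J where J: "\<And>j. j \<ge> J \<Longrightarrow> norm (\<Sum>n<q j. z n) / real (q j) < e / 2"
      "\<And>j. j \<ge> J \<Longrightarrow> real (q (Suc j)) / real (q j) < 1 + e / 2"
    by (auto simp: eventually_sequentially)
  show "\<exists>no. \<forall>N\<ge>no. norm ((\<Sum>n<N. z n) / of_nat N - 0) < e"
  proof (intro exI[of _ "q J"] allI impI)
    fix N assume N: "q J \<le> N"
    obtain j1 where j1: "\<And>j. j \<ge> j1 \<Longrightarrow> q j \<ge> Suc N"
      using q(2) unfolding filterlim_at_top eventually_sequentially by blast
    \<comment> \<open>The least index whose successor value exceeds \<open>N\<close>, so that
      \<open>q j \<le> N < q (Suc j)\<close>.\<close>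
    define j where "j = (LEAST j. q (Suc j) > N)"
    have ex: "q (Suc j1) > N" using j1[of "Suc j1"] by simp
    have jN: "q (Suc j) > N" unfolding j_def by (rule LeastI[of "\<lambda>j. q (Suc j) > N", OF ex])
    have jJ: "j \<ge> J"
      using N jN monoD[OF q(1), of "Suc j" J] by (meson not_less_eq_eq le_trans not_le)
    have jq: "q j \<le> N"
    proof (cases "j = J")
      case False
      then have "\<not> q (Suc (j - 1)) > N" unfolding j_def[symmetric]
        using jJ not_less_Least[of "j - 1" "\<lambda>j. q (Suc j) > N"] by (simp add: j_def[symmetric])
      then show ?thesis using False jJ by simp
    qed (use N in simp)
    have split: "(\<Sum>n<N. z n) = (\<Sum>n<q j. z n) + (\<Sum>n\<in>{q j..<N}. z n)"
      using sum.atLeastLessThan_concat[of 0 "q j" N z] jq by (simp add: lessThan_atLeast0)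
    have "norm (\<Sum>n\<in>{q j..<N}. z n) \<le> (\<Sum>n\<in>{q j..<N}. 1)"
      using z by (intro sum_norm_le) auto
    then have "norm (\<Sum>n<N. z n) \<le> norm (\<Sum>n<q j. z n) + (real N - real (q j))"
      unfolding split using jq by (intro norm_triangle_mono) (auto simp: of_nat_diff)
    also have "\<dots> \<le> norm (\<Sum>n<q j. z n) + (real (q (Suc j)) - real (q j))"
      using jN by simp
    also have "\<dots> < e / 2 * real (q j) + e / 2 * real (q j)"
      using J[OF jJ] q(3)[of j] by (intro add_strict_mono) (simp_all add: field_simps)
    also have "\<dots> \<le> e * real N" using jq e by simp
    finally show "norm ((\<Sum>n<N. z n) / of_nat N - 0) < e"
      using jq q(3)[of j] by (simp add: norm_divide divide_less_eq)
  qed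
qed

text \<open>As \<open>\<beta> < 1\<close>, the increments of \<open>j powr \<beta>\<close> tend to
  0; rounding up adds at most \<open>exp (- (j powr \<beta>))\<close> to the upper bound for the
  ratio.\<close>

lemma exp_powr_ratio:
  fixes \<beta> :: real
  assumes "0 < \<beta>" "\<beta> < 1"
  defines "q \<equiv> (\<lambda>j::nat. nat \<lceil>exp (real j powr \<beta>)\<rceil>)"
  shows "(\<lambda>j. real (q (Suc j)) / real (q j)) \<longlonglongrightarrow> 1"
proof -
  have q: "exp (real j powr \<beta>) \<le> real (q j)" "real (q j) \<le> exp (real j powr \<beta>) + 1" for j
    unfolding q_def by (auto simp: of_nat_nat intro: order_less_imp_le ceiling_correct)
  have lim: "(\<lambda>j. exp (real (Suc j) powr \<beta> - real j powr \<beta>) + exp (- (real j powr \<beta>))) \<longlonglongrightarrow> 1"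
    using assms(1,2) by real_asymp
  show ?thesis
  proof (rule tendsto_sandwich[OF always_eventually always_eventually tendsto_const lim]; intro allI)
    fix j
    have pos: "0 < real (q j)" using q(1)[of j] by (meson exp_gt_zero less_le_trans)
    have "q j \<le> q (Suc j)"
      unfolding q_def using assms(1) by (intro nat_mono ceiling_mono) (auto intro: powr_mono2)
    then show "1 \<le> real (q (Suc j)) / real (q j)" using pos by simp
    have "real (q (Suc j)) / real (q j) \<le> (exp (real (Suc j) powr \<beta>) + 1) / exp (real j powr \<beta>)"
      using q[of j] q[of "Suc j"] by (intro frac_le) auto
    also have "\<dots> = exp (real (Suc j) powr \<beta> - real j powr \<beta>) + exp (- (real j powr \<beta>))"
      by (simp add: add_divide_distrib exp_diff exp_minus divide_inverse distrib_right)
    finally show "real (q (Suc j)) / real (q j) \<le> exp (real (Suc j) powr \<beta> - real j powr \<beta>) + exp (- (real j powr \<beta>))" .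
  qed
qed

text \<open>The Davenport--Erdos--LeVeque argument: mean-square decay of order \<open>(ln N)\<^sup>-\<^sup>\<alpha>\<close> is summable
  along \<open>N\<^sub>j = \<lceil>exp (j\<^sup>\<beta>)\<rceil>\<close> because \<open>\<alpha>\<beta> > 1\<close>, and \<open>N\<^sub>j\<^sub>+\<^sub>1 / N\<^sub>j \<rightarrow> 1\<close> because \<open>\<beta> < 1\<close>.\<close>

lemma (in prob_space) AE_mean_tendsto_0:
  fixes f :: "nat \<Rightarrow> 'a \<Rightarrow> complex"
  assumes meas [measurable]: "\<And>n. f n \<in> borel_measurable M"
    and bound: "\<And>n x. norm (f n x) \<le> 1"
    and \<alpha>: "\<alpha> > 1"
    and sq: "eventually (\<lambda>N. (LINT x|M. (norm (\<Sum>n<N. f n x))\<^sup>2) \<le> C * real N ^ 2 / ln (real N) powr \<alpha>) sequentially"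
  shows "AE x in M. (\<lambda>N. (\<Sum>n<N. f n x) / of_nat N) \<longlonglongrightarrow> 0"
proof -
  \<comment> \<open>\<open>1 / \<beta>\<close> is the midpoint of 1 and \<open>\<alpha>\<close>, so
    both \<open>\<beta> < 1\<close> and \<open>\<alpha> * \<beta> > 1\<close> hold.\<close>
  define \<beta> where "\<beta> = 2 / (1 + \<alpha>)"
  have \<beta>: "0 < \<beta>" "\<beta> < 1" "\<alpha> * \<beta> > 1" using \<alpha> by (auto simp: \<beta>_def field_simps)
  define q where "q j = nat \<lceil>exp (real j powr \<beta>)\<rceil>" for j :: nat
  have q_ge: "exp (real j powr \<beta>) \<le> real (q j)" for j
    unfolding q_def by (auto simp: of_nat_nat)
  have q_pos: "q j > 0" for j using q_ge[of j] by (metis exp_gt_zero less_le_trans of_nat_0_less_iff)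
  have q_mono: "mono q"
    unfolding q_def using \<beta>(1) by (intro monoI nat_mono ceiling_mono) (auto intro: powr_mono2)
  have q_lim: "filterlim q at_top sequentially"
  proof -
    have "filterlim (\<lambda>j. exp (real j powr \<beta>)) at_top sequentially"
      using \<beta>(1) by real_asymp
    then have "filterlim (\<lambda>j. real (q j)) at_top sequentially"
      by (rule filterlim_at_top_mono) (use q_ge in auto)
    then show ?thesis by (simp add: filterlim_sequentially_iff_filterlim_real)
  qed
  define Y where "Y j x = (norm (\<Sum>n<q j. f n x) / real (q j))\<^sup>2" for j x
  have Ym [measurable]: "Y j \<in> borel_measurable M" for j unfolding Y_def by measurable
  have Y_int: "integrable M (\<lambda>x. (norm (\<Sum>n<N. f n x))\<^sup>2)" for N
  proof (rule integrable_const_bound[of _ "real N ^ 2"])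
    have "norm (\<Sum>n<N. f n x) \<le> real N" for x
      using sum_norm_le[of "{..<N}" "\<lambda>n. f n x" "\<lambda>_. 1"] bound by simp
    then show "AE x in M. norm ((norm (\<Sum>n<N. f n x))\<^sup>2) \<le> real N ^ 2"
      by (auto intro: power_mono)
  qed measurable
  have bnd: "eventually (\<lambda>j. (LINT x|M. Y j x) \<le> C * real j powr (- (\<alpha> * \<beta>))) sequentially"
    using eventually_compose_filterlim[OF sq q_lim] eventually_gt_at_top[of 0]
  proof eventually_elim
    case (elim j)
    have "(LINT x|M. Y j x) = (LINT x|M. (norm (\<Sum>n<q j. f n x))\<^sup>2) / real (q j) ^ 2"
      unfolding Y_def by (simp add: power_divide)
    also have "\<dots> \<le> C / ln (real (q j)) powr \<alpha>"
      using elim(1) q_pos[of j] by (simp add: field_simps)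
    finally have 1: "(LINT x|M. Y j x) \<le> C / ln (real (q j)) powr \<alpha>" .
    have jp: "real j powr \<beta> > 0" using elim by simp
    have l: "real j powr \<beta> \<le> ln (real (q j))"
      using q_ge[of j] q_pos[of j] by (simp add: ln_ge_iff)
    \<comment> \<open>The sign of \<open>C\<close> is read off from a nonnegative mean square; it is
      needed to compare the two denominators.\<close>
    have "0 \<le> (LINT x|M. Y j x)" by (intro Bochner_Integration.integral_nonneg) (auto simp: Y_def)
    with 1 have "0 \<le> C / ln (real (q j)) powr \<alpha>" by linarith
    moreover have "ln (real (q j)) > 0" using l jp by linarith
    then have "ln (real (q j)) powr \<alpha> > 0" by simp
    ultimately have "C \<ge> 0" by (simp add: zero_le_divide_iff)
    have "C / ln (real (q j)) powr \<alpha> \<le> C / (real j powr \<beta>) powr \<alpha>"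
      using l jp \<alpha> \<open>C \<ge> 0\<close> by (intro divide_left_mono powr_mono2 mult_pos_pos) auto
    also have "\<dots> = C * real j powr (- (\<alpha> * \<beta>))"
      by (simp add: powr_powr powr_minus divide_inverse mult.commute)
    finally show ?case using 1 by linarith
  qed
  have "summable (\<lambda>j. LINT x|M. Y j x)"
  proof (rule summable_comparison_test_ev)
    show "eventually (\<lambda>j. norm (LINT x|M. Y j x) \<le> C * real j powr (- (\<alpha> * \<beta>))) sequentially"
      using bnd by eventually_elim (auto intro!: Bochner_Integration.integral_nonneg simp: Y_def)
    show "summable (\<lambda>j. C * real j powr (- (\<alpha> * \<beta>)))"
      using \<beta>(3) by (intro summable_mult) (simp add: summable_real_powr_iff)
  qed
  moreover have Yi: "integrable M (Y j)" for j
    unfolding Y_def power_divide using Y_int by (intro integrable_divide_zero) auto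
  ultimately have "(\<Sum>j. ennreal (LINT x|M. Y j x)) \<noteq> top"
    by (intro ennreal_suminf_neq_top) (auto intro!: Bochner_Integration.integral_nonneg simp: Y_def)
  moreover have "(\<integral>\<^sup>+x. ennreal (Y j x) \<partial>M) = ennreal (LINT x|M. Y j x)" for j
    by (rule nn_integral_eq_integral[OF Yi]) (simp add: Y_def)
  ultimately have "(\<Sum>j. \<integral>\<^sup>+x. ennreal (Y j x) \<partial>M) \<noteq> \<infinity>"
    by simp
  \<comment> \<open>By monotone convergence the sum of the \<open>Y j\<close> has finite integral,
    so it is finite almost everywhere and its terms tend to 0.\<close>
  then have "(\<integral>\<^sup>+x. (\<Sum>j. ennreal (Y j x)) \<partial>M) \<noteq> \<infinity>"
    by (subst nn_integral_suminf) auto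
  then have "AE x in M. (\<Sum>j. ennreal (Y j x)) \<noteq> \<infinity>"
    by (intro nn_integral_PInf_AE) auto
  then show ?thesis
  proof eventually_elim
    case (elim x)
    then have "summable (\<lambda>j. Y j x)"
      by (intro summable_suminf_not_top) (auto simp: Y_def)
    then have "(\<lambda>j. Y j x) \<longlonglongrightarrow> 0" by (rule summable_LIMSEQ_zero)
    then have "(\<lambda>j. sqrt (Y j x)) \<longlonglongrightarrow> sqrt 0" by (intro tendsto_real_sqrt)
    then have "(\<lambda>j. norm (\<Sum>n<q j. f n x) / real (q j)) \<longlonglongrightarrow> 0"
      by (simp add: Y_def)
    moreover have "(\<lambda>j. real (q (Suc j)) / real (q j)) \<longlonglongrightarrow> 1"
      unfolding q_def by (rule exp_powr_ratio[OF \<beta>(1,2)])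
    ultimately show ?case
      by (intro mean_interpolate[of _ q]) (use bound q_mono q_lim q_pos in auto)
  qed
qed

section \<open>Growth and spacing of the sequence\<close>

lemma pow23_inj:
  assumes "(2::nat) ^ j * 3 ^ k = 2 ^ j' * 3 ^ k'"
  shows "j = j'" "k = k'"
proof -
  have m: "multiplicity 2 ((2::nat) ^ a * 3 ^ b) = a" "multiplicity 3 ((2::nat) ^ a * 3 ^ b) = b" for a b
    by (simp_all add: prime_elem_multiplicity_mult_distrib multiplicity_distinct_prime_power prime_elem_multiplicity_power_distrib)
  show "j = j'" "k = k'" using m[of j k] m[of j' k'] assms by auto
qed

lemma range_s23: "range s23 = S23"
  unfolding s23_def by (rule range_enumerate[OF infinite_S23])

lemma strict_mono_s23: "strict_mono s23"
  unfolding s23_def by (rule strict_mono_enumerate[OF infinite_S23])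

lemma s23_less_iff: "s23 m < s23 n \<longleftrightarrow> m < n"
  using strict_mono_less[OF strict_mono_s23] .

lemma s23_le_iff: "s23 m \<le> s23 n \<longleftrightarrow> m \<le> n"
  using strict_mono_less_eq[OF strict_mono_s23] .

lemma card_S23_below: "card {n. s23 n \<le> x} = card {s \<in> S23. s \<le> x}"
proof -
  have "{s \<in> S23. s \<le> x} = s23 ` {n. s23 n \<le> x}"
    using range_s23 by auto
  moreover have "inj_on s23 {n. s23 n \<le> x}"
    using strict_mono_s23 by (meson strict_mono_imp_inj_on inj_on_subset subset_UNIV)
  ultimately show ?thesis by (simp add: card_image)
qed

text \<open>An element of \<open>S23\<close> below \<open>2 ^ r\<close> has both exponents below
  \<open>r\<close>, so at most \<open>r\<^sup>2\<close> such elements exist. Indices start at 0, so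
  there are already \<open>n + 1\<close> terms up to \<open>s23 n\<close>.\<close>

lemma s23_ge: "r\<^sup>2 \<le> n \<Longrightarrow> 2 ^ r \<le> s23 n"
proof (rule ccontr)
  assume n: "r\<^sup>2 \<le> n" and "\<not> 2 ^ r \<le> s23 n"
  then have lt: "s23 m < 2 ^ r" if "m \<le> n" for m
    using that s23_le_iff[of m n] by linarith
  have "s23 ` {..n} \<subseteq> (\<lambda>(j, k). 2 ^ j * 3 ^ k) ` ({..<r} \<times> {..<r})"
  proof safe
    fix m assume m: "m \<le> n"
    have "s23 m \<in> S23" using range_s23 by auto
    then obtain j k where jk: "s23 m = 2 ^ j * 3 ^ k" unfolding S23_def by auto
    have "2 ^ j * 3 ^ k < (2::nat) ^ r" using lt[OF m] jk by simp
    moreover have "(2::nat) ^ j \<le> 2 ^ j * 3 ^ k" "(2::nat) ^ k \<le> 2 ^ j * 3 ^ k"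
      using mult_le_mono[of 1 "2^j" "2^k" "3^k :: nat"] power_mono[of 2 "3::nat" k] by auto
    ultimately have "(2::nat) ^ j < 2 ^ r" "(2::nat) ^ k < 2 ^ r" by linarith+
    then have "j < r" "k < r" by simp_all
    then show "s23 m \<in> (\<lambda>(j, k). 2 ^ j * 3 ^ k) ` ({..<r} \<times> {..<r})" using jk by force
  qed
  then have "card (s23 ` {..n}) \<le> card ({..<r} \<times> {..<r})"
    by (meson card_image_le card_mono finite_SigmaI finite_imageI finite_lessThan order_trans)
  moreover have "card (s23 ` {..n}) = Suc n"
    using strict_mono_s23 by (subst card_image) (auto intro: strict_mono_imp_inj_on inj_on_subset)
  ultimately show False using n by (simp add: power2_eq_square)
qed

text \<open>The \<open>r\<^sup>2\<close> products with both exponents below \<open>r\<close> are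
  distinct and at most \<open>6 ^ r\<close>, while only \<open>n\<close> terms precede
  \<open>s23 n\<close>.\<close>

lemma s23_le: "n < r\<^sup>2 \<Longrightarrow> s23 n \<le> 6 ^ r"
proof (rule ccontr)
  assume n: "n < r\<^sup>2" and gt: "\<not> s23 n \<le> 6 ^ r"
  have "(\<lambda>(j, k). 2 ^ j * 3 ^ k) ` ({..<r} \<times> {..<r}) \<subseteq> s23 ` {..<n}"
  proof safe
    fix j k assume "j < r" "k < r"
    then have "2 ^ j * 3 ^ k \<le> (2::nat) ^ r * 3 ^ r" by (intro mult_le_mono power_increasing) auto
    also have "\<dots> = 6 ^ r" by (simp flip: power_mult_distrib)
    finally have le: "2 ^ j * 3 ^ k < s23 n" using gt by simp
    have "2 ^ j * 3 ^ k \<in> range s23" unfolding range_s23 S23_def by auto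
    then obtain m where "2 ^ j * 3 ^ k = s23 m" by auto
    then show "2 ^ j * 3 ^ k \<in> s23 ` {..<n}" using le s23_less_iff by auto
  qed
  then have "card ((\<lambda>(j, k). (2::nat) ^ j * 3 ^ k) ` ({..<r} \<times> {..<r})) \<le> card {..<n}"
    by (meson card_image_le card_mono finite_imageI finite_lessThan order_trans)
  moreover have "inj_on (\<lambda>(j, k). (2::nat) ^ j * 3 ^ k) ({..<r} \<times> {..<r})"
    by (auto intro!: inj_onI dest: pow23_inj)
  ultimately show False using n by (simp add: card_image power2_eq_square)
qed

text \<open>Distinct elements sharing a power of 3 differ by a factor of at least 2, so each
  exponent of 3 contributes at most one index with \<open>s23 n / 2 < s23 m < s23 n\<close>. That
  exponent is at most \<open>2 * r\<close>, because \<open>3 ^ k \<le> 6 ^ r \<le> 9 ^ r\<close>.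
  For all other \<open>m < n\<close> the difference \<open>s23 n - s23 m\<close> is at least half of
  \<open>s23 n\<close>.\<close>

lemma card_near:
  assumes "n < r\<^sup>2"
  shows "card {m. m < n \<and> s23 n < 2 * s23 m} \<le> 2 * r + 1"
proof -
  let ?A = "\<lambda>k. {m. m < n \<and> s23 n < 2 * s23 m \<and> (\<exists>j. s23 m = 2 ^ j * 3 ^ k)}"
  have "{m. m < n \<and> s23 n < 2 * s23 m} \<subseteq> (\<Union>k\<in>{..2 * r}. ?A k)"
  proof safe
    fix m assume m: "m < n" "s23 n < 2 * s23 m"
    have "s23 m \<in> S23" using range_s23 by auto
    then obtain j k where jk: "s23 m = 2 ^ j * 3 ^ k" unfolding S23_def by auto
    have "(3::nat) ^ k \<le> 2 ^ j * 3 ^ k" by simp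
    also have "\<dots> \<le> 6 ^ r" using s23_le[of m r] m assms jk by simp
    also have "(6::nat) ^ r \<le> 9 ^ r" by (intro power_mono) auto
    also have "(9::nat) ^ r = 3 ^ (2 * r)" by (simp add: power_mult)
    finally have "k \<le> 2 * r" by simp
    then show "m \<in> (\<Union>k\<in>{..2 * r}. ?A k)" using m jk by auto
  qed
  then have "card {m. m < n \<and> s23 n < 2 * s23 m} \<le> card (\<Union>k\<in>{..2 * r}. ?A k)"
    by (intro card_mono) auto
  also have "\<dots> \<le> (\<Sum>k\<in>{..2 * r}. card (?A k))" by (intro card_UN_le) auto
  also have "\<dots> \<le> (\<Sum>k\<in>{..2 * r}. 1)"
  proof (rule sum_mono)
    fix k
    have "m \<le> m'" if "m \<in> ?A k" "m' \<in> ?A k" for m m'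
    proof (rule ccontr)
      assume "\<not> m \<le> m'"
      then have lt: "s23 m' < s23 m" using s23_less_iff by simp
      from that obtain j j' where j: "s23 m = 2 ^ j * 3 ^ k" "s23 m' = 2 ^ j' * 3 ^ k" by auto
      have "j' < j" using lt unfolding j by simp
      then have "(2::nat) ^ Suc j' \<le> 2 ^ j" by (intro power_increasing) auto
      then have "2 * s23 m' \<le> s23 m" unfolding j by simp
      also have "\<dots> < s23 n" using that s23_less_iff by simp
      finally show False using that by simp
    qed
    then have same: "m = m'" if "m \<in> ?A k" "m' \<in> ?A k" for m m'
      using that by (intro antisym)
    have fin: "finite (?A k)" by simp
    show "card (?A k) \<le> 1"
      unfolding One_nat_def card_le_Suc0_iff_eq[OF fin] by (intro ballI same)
  qed
  finally show ?thesis by simp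
qed

lemma sum_near_le:
  "(\<Sum>n<N. \<Sum>m<n. if s23 n < 2 * s23 m then 1 else 0 :: real) \<le> real N * (2 * sqrt (real N) + 3)"
proof -
  define r where "r = nat \<lceil>sqrt (real N)\<rceil>"
  have r: "sqrt (real N) \<le> real r" "real r \<le> sqrt (real N) + 1"
    unfolding r_def by (auto simp: of_nat_nat intro: order_less_imp_le ceiling_correct)
  have "real N = (sqrt (real N))\<^sup>2" by simp
  also have "\<dots> \<le> (real r)\<^sup>2" using r by (intro power_mono) auto
  finally have N: "N \<le> r\<^sup>2" by (simp flip: of_nat_power)
  have "(\<Sum>m<n. if s23 n < 2 * s23 m then 1 else 0 :: real) \<le> 2 * sqrt (real N) + 3" if "n < N" for n
  proof -
    have "(\<Sum>m<n. if s23 n < 2 * s23 m then 1 else 0 :: real) = real (card ({..<n} \<inter> {m. s23 n < 2 * s23 m}))"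
      by (simp add: sum.If_cases)
    also have "{..<n} \<inter> {m. s23 n < 2 * s23 m} = {m. m < n \<and> s23 n < 2 * s23 m}" by auto
    also have "real (card \<dots>) \<le> real (2 * r + 1)"
      using card_near[of n r] that N by (simp only: of_nat_le_iff)
    finally show ?thesis using r by simp
  qed
  then show ?thesis using sum_mono[of "{..<N}" _ "\<lambda>_. 2 * sqrt (real N) + 3"] by simp
qed

lemma sum_square_symmetric:
  fixes w :: "nat \<Rightarrow> nat \<Rightarrow> real"
  assumes "\<And>m n. w m n = w n m"
  shows "(\<Sum>n<N. \<Sum>m<N. w m n) = (\<Sum>n<N. w n n) + 2 * (\<Sum>n<N. \<Sum>m<n. w m n)"
proof (induction N)
  case (Suc N)
  have "(\<Sum>n<N. w N n) = (\<Sum>m<N. w m N)" using assms by metis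
  with Suc show ?case by (simp add: sum.distrib)
qed simp

section \<open>Mean squares expressed by Fourier coefficients\<close>

lemma torus_prob_space: "torus_prob_measure \<mu> \<Longrightarrow> prob_space \<mu>"
  by (simp add: torus_prob_measure_def)

lemma torus_measurable:
  "torus_prob_measure \<mu> \<Longrightarrow> f \<in> borel_measurable borel \<Longrightarrow> f \<in> borel_measurable \<mu>"
  unfolding torus_prob_measure_def
  by (metis measurable_cong_sets measurable_restrict_space1)

lemma ee_integrable: "torus_prob_measure \<mu> \<Longrightarrow> integrable \<mu> (ee k)"
  using torus_measurable[of \<mu> "ee k"] torus_prob_space[of \<mu>]
  by (auto intro!: finite_measure.integrable_const_bound[of _ _ 1] simp: prob_space_def)

lemma norm_fourier_coeff_le: "torus_prob_measure \<mu> \<Longrightarrow> norm (fourier_coeff \<mu> h) \<le> 1"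
proof -
  assume \<mu>: "torus_prob_measure \<mu>"
  then interpret prob_space \<mu> by (rule torus_prob_space)
  have "norm (fourier_coeff \<mu> h) \<le> (LINT x|\<mu>. norm (ee (- h) x))"
    unfolding fourier_coeff_eq by (rule integral_norm_bound)
  then show ?thesis by (simp add: prob_space)
qed

lemma norm_fourier_coeff_uminus: "norm (fourier_coeff \<mu> (- h)) = norm (fourier_coeff \<mu> h)"
proof -
  have "fourier_coeff \<mu> (- h) = cnj (fourier_coeff \<mu> h)"
    using Bochner_Integration.integral_cnj[of \<mu> "ee (- h)"] by (simp add: fourier_coeff_eq cnj_ee)
  then show ?thesis by simp
qed

lemma square_integral_le:
  fixes a :: "nat \<Rightarrow> int"
  assumes \<mu>: "torus_prob_measure \<mu>"
  shows "(LINT x|\<mu>. (norm (\<Sum>n<N. ee (a n) x))\<^sup>2) \<le> (\<Sum>n<N. \<Sum>m<N. norm (fourier_coeff \<mu> (a n - a m)))"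
proof -
  have "complex_of_real ((norm (\<Sum>n<N. ee (a n) x))\<^sup>2) = (\<Sum>n<N. \<Sum>m<N. ee (- (a n - a m)) x)" for x
  proof -
    have "complex_of_real ((norm (\<Sum>n<N. ee (a n) x))\<^sup>2)
        = (\<Sum>m<N. ee (a m) x) * cnj (\<Sum>n<N. ee (a n) x)"
      by (rule complex_norm_square)
    also have "\<dots> = (\<Sum>m<N. \<Sum>n<N. ee (- (a n - a m)) x)"
      by (simp add: cnj_ee sum_product ee_mult)
    finally show ?thesis by (subst sum.swap)
  qed
  then have "complex_of_real (LINT x|\<mu>. (norm (\<Sum>n<N. ee (a n) x))\<^sup>2)
      = (LINT x|\<mu>. (\<Sum>n<N. \<Sum>m<N. ee (- (a n - a m)) x))"
    by (subst integral_complex_of_real[symmetric]) simp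
  also have "\<dots> = (\<Sum>n<N. \<Sum>m<N. fourier_coeff \<mu> (a n - a m))"
    using ee_integrable[OF \<mu>] by (simp add: fourier_coeff_eq)
  finally have "complex_of_real (LINT x|\<mu>. (norm (\<Sum>n<N. ee (a n) x))\<^sup>2)
      = (\<Sum>n<N. \<Sum>m<N. fourier_coeff \<mu> (a n - a m))" .
  from arg_cong[OF this, of norm]
  have "\<bar>LINT x|\<mu>. (norm (\<Sum>n<N. ee (a n) x))\<^sup>2\<bar> = norm (\<Sum>n<N. \<Sum>m<N. fourier_coeff \<mu> (a n - a m))"
    by (simp only: norm_of_real)
  also have "\<dots> \<le> (\<Sum>n<N. \<Sum>m<N. norm (fourier_coeff \<mu> (a n - a m)))"
    by (intro sum_norm_le order_refl)
  finally show ?thesis by linarith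
qed

text \<open>The diagonal gives \<open>N\<close>. Pairs \<open>m < n\<close> fall into three classes:
  close pairs, counted by \<open>sum_near_le\<close>; pairs with \<open>n < p\<^sup>2\<close>, at
  most \<open>p ^ 4\<close> of them; and the rest, where \<open>s23_ge\<close> makes the frequency
  at least \<open>s23 n / 2 \<ge> 2 ^ (p - 1)\<close>, so that the coefficient is at most
  \<open>\<delta>\<close>.\<close>

lemma energy_bound:
  assumes \<mu>: "torus_prob_measure \<mu>" and k: "k > 0" and p: "p > 0"
    and \<delta>: "\<And>h. h \<ge> 2 ^ (p - 1) \<Longrightarrow> norm (fourier_coeff \<mu> h) \<le> \<delta>" "\<delta> \<ge> 0"
  shows "(LINT x|\<mu>. (norm (\<Sum>n<N. ee (k * int (s23 n)) x))\<^sup>2)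
    \<le> real N + 2 * (real N * (2 * sqrt (real N) + 3) + real p ^ 4 + real N ^ 2 * \<delta>)"
proof -
  let ?w = "\<lambda>m n. norm (fourier_coeff \<mu> (k * int (s23 n) - k * int (s23 m)))"
  have sym: "?w m n = ?w n m" for m n
    using norm_fourier_coeff_uminus[of \<mu> "k * int (s23 n) - k * int (s23 m)"] by simp
  have w: "?w m n \<le> (if s23 n < 2 * s23 m then 1 else 0) + (if n < p\<^sup>2 then 1 else 0) + \<delta>"
    if mn: "m < n" for m n
  proof (cases "s23 n < 2 * s23 m \<or> n < p\<^sup>2")
    case True
    then show ?thesis
      using norm_fourier_coeff_le[OF \<mu>, of "k * int (s23 n) - k * int (s23 m)"] \<delta>(2) by auto
  next
    case False
    then have "2 ^ p \<le> s23 n" using s23_ge by simp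
    then have "int (2 ^ p) \<le> int (s23 n)" by (simp only: of_nat_le_iff)
    then have "2 ^ p \<le> int (s23 n)" by simp
    moreover have "(2::int) ^ p = 2 * 2 ^ (p - 1)" using p by (cases p) auto
    ultimately have "2 ^ (p - 1) \<le> int (s23 n) - int (s23 m)" using False by linarith
    also have "\<dots> \<le> k * (int (s23 n) - int (s23 m))"
      using k mn s23_less_iff[of m n] mult_right_mono[of 1 k "int (s23 n) - int (s23 m)"] by simp
    finally have "?w m n \<le> \<delta>" by (intro \<delta>(1)) (simp add: right_diff_distrib)
    then show ?thesis using False by auto
  qed
  have "(LINT x|\<mu>. (norm (\<Sum>n<N. ee (k * int (s23 n)) x))\<^sup>2) \<le> (\<Sum>n<N. \<Sum>m<N. ?w m n)"
    by (rule square_integral_le[OF \<mu>])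
  also have "\<dots> = (\<Sum>n<N. ?w n n) + 2 * (\<Sum>n<N. \<Sum>m<n. ?w m n)"
    using sym by (rule sum_square_symmetric)
  also have "(\<Sum>n<N. ?w n n) \<le> (\<Sum>n<N. 1)"
    using norm_fourier_coeff_le[OF \<mu>] by (intro sum_mono)
  also have "(\<Sum>n<N. \<Sum>m<n. ?w m n) \<le>
      (\<Sum>n<N. \<Sum>m<n. (if s23 n < 2 * s23 m then 1 else 0) + (if n < p\<^sup>2 then 1 else 0) + \<delta>)"
    by (intro sum_mono w) auto
  also have "\<dots> = (\<Sum>n<N. \<Sum>m<n. if s23 n < 2 * s23 m then 1 else 0)
      + (\<Sum>n<N. \<Sum>m<n. if n < p\<^sup>2 then 1 else 0) + (\<Sum>n<N. \<Sum>m<n. \<delta>)"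
    by (simp only: sum.distrib)
  also have "(\<Sum>n<N. \<Sum>m<n. if n < p\<^sup>2 then 1 else 0 :: real) \<le> real p ^ 4"
  proof -
    have "(\<Sum>n<N. \<Sum>m<n. if n < p\<^sup>2 then 1 else 0 :: real) = (\<Sum>n\<in>{..<N} \<inter> {n. n < p\<^sup>2}. real n)"
      by (subst sum.inter_restrict) (auto intro!: sum.cong)
    also have "\<dots> \<le> (\<Sum>n\<in>{..<p\<^sup>2}. real (p\<^sup>2))"
      by (rule order_trans[OF sum_mono2[of "{..<p\<^sup>2}"] sum_mono]) auto
    finally show ?thesis by (simp flip: power_add power_mult)
  qed
  also have "(\<Sum>n<N. \<Sum>m<n. \<delta>) \<le> (\<Sum>n<N. \<Sum>m<N. \<delta>)"
    by (intro sum_mono sum_mono2) (use \<delta>(2) in auto)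
  finally show ?thesis using sum_near_le[of N] by (simp add: power2_eq_square)
qed

lemma eventually_energy_bound:
  assumes \<mu>: "torus_prob_measure \<mu>" and k: "k > 0" and \<alpha>: "\<alpha> > 0"
    and O: "(\<lambda>h::int. norm (fourier_coeff \<mu> h)) \<in> O[at_top](\<lambda>h. 1 / (ln (ln (real_of_int h))) powr \<alpha>)"
  shows "\<exists>C. eventually (\<lambda>N. (LINT x|\<mu>. (norm (\<Sum>n<N. ee (k * int (s23 n)) x))\<^sup>2)
      \<le> C * real N ^ 2 / ln (real N) powr \<alpha>) sequentially"
proof -
  from O obtain B where B: "B > 0"
    "eventually (\<lambda>h::int. norm (fourier_coeff \<mu> h) \<le> B * (1 / (ln (ln (real_of_int h))) powr \<alpha>)) at_top"
    by (auto elim!: landau_o.bigE)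
  from B(2) obtain h0 where h0: "\<And>h. h \<ge> h0 \<Longrightarrow> norm (fourier_coeff \<mu> h) \<le> B * (1 / (ln (ln (real_of_int h))) powr \<alpha>)"
    unfolding eventually_at_top_linorder by auto
  \<comment> \<open>The exponent \<open>1/4\<close> balances two needs: \<open>p ^ 4 \<le> N\<close>
    is negligible against \<open>N\<^sup>2\<close>, while \<open>2 ^ (p - 1)\<close> still has an
    iterated logarithm of order \<open>ln N\<close>.\<close>
  define p where "p N = nat \<lfloor>real N powr (1/4)\<rfloor>" for N :: nat
  have p: "real (p N) \<le> real N powr (1/4)" "real N powr (1/4) - 1 \<le> real (p N)" for N
    unfolding p_def by (auto simp: of_nat_nat)
  have p4: "real (p N) ^ 4 \<le> real N" for N
  proof -
    have "real (p N) ^ 4 \<le> (real N powr (1/4)) ^ 4" using p by (intro power_mono) auto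
    also have "\<dots> = real N" by (cases "N = 0") (auto simp: powr_powr simp flip: powr_realpow)
    finally show ?thesis .
  qed
  \<comment> \<open>The main term is \<open>ln N / 4\<close>; the divisor 8 absorbs the rounding,
    the shift and the factor \<open>ln 2\<close>.\<close>
  have 1: "eventually (\<lambda>N. ln ((real N powr (1/4) - 2) * ln 2) \<ge> ln (real N) / 8) sequentially"
    by real_asymp
  have 2: "eventually (\<lambda>N. real N powr (1/4) - 2 \<ge> max 2 (real_of_int h0)) sequentially"
    by real_asymp
  have 3: "eventually (\<lambda>N. ln (real N) powr \<alpha> * (real N + 2 * (real N * (2 * sqrt (real N) + 3) + real N)) \<le> real N ^ 2) sequentially"
    using \<alpha> by real_asymp
  have 4: "eventually (\<lambda>N. N > 2) sequentially" by (rule eventually_gt_at_top)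
  \<comment> \<open>The summand 1 absorbs the lower order terms; the other one comes from
    \<open>2 * N\<^sup>2 * \<delta>\<close>.\<close>
  define C where "C = 1 + 2 * B * 8 powr \<alpha>"
  have "eventually (\<lambda>N. (LINT x|\<mu>. (norm (\<Sum>n<N. ee (k * int (s23 n)) x))\<^sup>2)
      \<le> C * real N ^ 2 / ln (real N) powr \<alpha>) sequentially"
    using 1 2 3 4
  proof eventually_elim
    case (elim N)
    have lnN: "ln (real N) > 0" using elim(4) by simp
    define \<delta> where "\<delta> = B * 8 powr \<alpha> / ln (real N) powr \<alpha>"
    have p1: "real (p N - 1) \<ge> real N powr (1/4) - 2" "p N > 0" "real (p N - 1) \<ge> real_of_int h0" "p N - 1 \<ge> 2"
      using p[of N] elim(2) by (auto simp: of_nat_diff)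
    have \<delta>: "norm (fourier_coeff \<mu> h) \<le> \<delta>" if "h \<ge> 2 ^ (p N - 1)" for h
    proof -
      have hp: "real_of_int h \<ge> 2 ^ (p N - 1)"
        using that by (metis of_int_le_iff of_int_numeral of_int_power)
      have "real (p N - 1) \<le> 2 ^ (p N - 1)" by (metis less_imp_le of_nat_less_two_power)
      then have "h \<ge> h0" using hp p1(3) by linarith
      have "(real N powr (1/4) - 2) * ln 2 \<le> real (p N - 1) * ln 2"
        using p1(1) by (intro mult_right_mono) auto
      also have "\<dots> = ln (2 ^ (p N - 1))" by (simp add: ln_realpow)
      also have "\<dots> \<le> ln (real_of_int h)"
        using hp by (subst ln_le_cancel_iff) (auto intro: less_le_trans[rotated])
      finally have le: "(real N powr (1/4) - 2) * ln 2 \<le> ln (real_of_int h)" .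
      have "(real N powr (1/4) - 2) * ln 2 > 0" using elim(2) by simp
      then have "ln ((real N powr (1/4) - 2) * ln 2) \<le> ln (ln (real_of_int h))"
        using le by (subst ln_le_cancel_iff) auto
      with elim(1) have l: "ln (real N) / 8 \<le> ln (ln (real_of_int h))" by linarith
      have "norm (fourier_coeff \<mu> h) \<le> B * (1 / (ln (ln (real_of_int h))) powr \<alpha>)"
        by (rule h0) fact
      also have "\<dots> \<le> B * (1 / (ln (real N) / 8) powr \<alpha>)"
        using l lnN \<alpha> B(1) by (intro mult_left_mono divide_left_mono powr_mono2) auto
      also have "\<dots> = \<delta>" using lnN by (simp add: \<delta>_def powr_divide)
      finally show ?thesis .
    qed
    have "(LINT x|\<mu>. (norm (\<Sum>n<N. ee (k * int (s23 n)) x))\<^sup>2)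
      \<le> real N + 2 * (real N * (2 * sqrt (real N) + 3) + real (p N) ^ 4 + real N ^ 2 * \<delta>)"
      by (rule energy_bound[OF \<mu> k p1(2) \<delta>]) (use B in \<open>auto simp: \<delta>_def\<close>)
    also have "\<dots> \<le> (real N + 2 * (real N * (2 * sqrt (real N) + 3) + real N)) + 2 * real N ^ 2 * \<delta>"
      using p4[of N] by simp
    also have "\<dots> \<le> real N ^ 2 / ln (real N) powr \<alpha> + 2 * real N ^ 2 * \<delta>"
    proof -
      have "ln (real N) powr \<alpha> > 0" using lnN by simp
      then have "real N + 2 * (real N * (2 * sqrt (real N) + 3) + real N) \<le> real N ^ 2 / ln (real N) powr \<alpha>"
        using elim(3) by (subst pos_le_divide_eq) (auto simp: mult.commute)
      then show ?thesis by linarith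
    qed
    also have "\<dots> = C * real N ^ 2 / ln (real N) powr \<alpha>"
      by (simp add: C_def \<delta>_def distrib_left distrib_right add_divide_distrib mult_ac)
    finally show ?case .
  qed
  then show ?thesis by blast
qed

theorem AE_equidistributed:
  assumes \<mu>: "torus_prob_measure \<mu>" and \<alpha>: "\<alpha> > 1"
    and O: "(\<lambda>h::int. norm (fourier_coeff \<mu> h)) \<in> O[at_top](\<lambda>h. 1 / (ln (ln (real_of_int h))) powr \<alpha>)"
  shows "AE x in \<mu>. equidistributed_mod1 (\<lambda>n. real (s23 n) * x)"
proof -
  interpret prob_space \<mu> using \<mu> by (rule torus_prob_space)
  have "AE x in \<mu>. (\<lambda>N. (\<Sum>n<N. ee (k * int (s23 n)) x) / of_nat N) \<longlonglongrightarrow> 0" if k: "k > 0" for k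
  proof -
    obtain C where "eventually (\<lambda>N. (LINT x|\<mu>. (norm (\<Sum>n<N. ee (k * int (s23 n)) x))\<^sup>2)
      \<le> C * real N ^ 2 / ln (real N) powr \<alpha>) sequentially"
      using eventually_energy_bound[OF \<mu> k _ O] \<alpha> by auto
    then show ?thesis
      using torus_measurable[OF \<mu> borel_measurable_ee] \<alpha> by (intro AE_mean_tendsto_0[of _ \<alpha> C]) auto
  qed
  \<comment> \<open>Only countably many \<open>k\<close> occur, so one null set serves all of them;
    negative \<open>k\<close> are recovered by conjugation.\<close>
  then have "AE x in \<mu>. \<forall>k::int. k > 0 \<longrightarrow> (\<lambda>N. (\<Sum>n<N. ee (k * int (s23 n)) x) / of_nat N) \<longlonglongrightarrow> 0"
    by (subst AE_all_countable) auto
  then show ?thesis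
  proof eventually_elim
    case (elim x)
    have pos: "(\<lambda>N. (\<Sum>n<N. ee k (real (s23 n) * x)) / of_nat N) \<longlonglongrightarrow> 0" if "k > 0" for k
      using elim that ee_scale[of k "int (s23 _)" x] by simp
    interpret weyl_sums "\<lambda>n. real (s23 n) * x"
    proof
      fix k :: int assume "k \<noteq> 0"
      then consider "k > 0" | "- k > 0" by linarith
      then show "(\<lambda>N. (\<Sum>n<N. ee k (real (s23 n) * x)) / of_nat N) \<longlonglongrightarrow> 0"
      proof cases
        case 2
        from tendsto_cnj[OF pos[OF this]] show ?thesis by (simp add: cnj_ee)
      qed (rule pos)
    qed
    show ?case by (rule equidistributed)
  qed
qed

corollary measure_W23_neq_1:
  assumes \<mu>: "torus_prob_measure \<mu>" and \<alpha>: "\<alpha> > 1"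
    and O: "(\<lambda>h::int. norm (fourier_coeff \<mu> h)) \<in> O[at_top](\<lambda>h. 1 / (ln (ln (real_of_int h))) powr \<alpha>)"
  shows "measure \<mu> W23 \<noteq> 1"
proof
  interpret prob_space \<mu> using \<mu> by (rule torus_prob_space)
  assume 1: "measure \<mu> W23 = 1"
  \<comment> \<open>\<open>measure\<close> vanishes on non-measurable sets, so the value 1 forces
    measurability.\<close>
  then have "W23 \<in> sets \<mu>" by (metis measure_notin_sets zero_neq_one)
  with 1 have "AE x in \<mu>. x \<in> W23" using AE_in_set_eq_1 by blast
  with AE_equidistributed[OF assms] have "AE x in \<mu>. False"
    by eventually_elim (simp add: W23_def)
  then show False by simp
qed

section \<open>Averaged Riesz products of Fejer kernels\<close>

text \<open>The Fejer kernel of order \<open>m\<close>, with coefficient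
  \<open>1 - \<bar>j\<bar> / m\<close> at \<open>j\<close> for \<open>\<bar>j\<bar> < m\<close>.
  Written as a square, it is visibly nonnegative.\<close>

definition fejer :: "nat \<Rightarrow> real \<Rightarrow> real" where
  "fejer m y = (norm (\<Sum>r<m. ee (int r) y))\<^sup>2 / real m"

lemma fejer_nonneg: "0 \<le> fejer m y"
  by (simp add: fejer_def)

lemma fejer_eq:
  "of_real (fejer m (of_int q * y)) = (\<Sum>r<m. \<Sum>s<m. ee ((int r - int s) * q) y) / of_nat m"
proof -
  have "complex_of_real ((norm (\<Sum>r<m. ee (int r) (of_int q * y)))\<^sup>2)
      = (\<Sum>r<m. ee (int r) (of_int q * y)) * cnj (\<Sum>s<m. ee (int s) (of_int q * y))"
    by (rule complex_norm_square)
  also have "\<dots> = (\<Sum>r<m. \<Sum>s<m. ee ((int r - int s) * q) y)"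
    by (simp add: cnj_ee ee_scale sum_product ee_mult left_diff_distrib)
  finally show ?thesis by (simp add: fejer_def)
qed

lemma trig_fejer:
  assumes "q \<ge> 0"
  shows "trig (int m * q) (\<lambda>y. of_real (fejer m (of_int q * y)))"
proof -
  have "trig (int m * q) (\<lambda>y. (\<Sum>r<m. \<Sum>s<m. (1 / of_nat m) * ee ((int r - int s) * q) y))"
  proof (intro trig_sum trig.monom)
    fix r s assume "r \<in> {..<m}" "s \<in> {..<m}"
    then have "\<bar>int r - int s\<bar> \<le> int m" by auto
    then show "\<bar>(int r - int s) * q\<bar> \<le> int m * q"
      using assms by (simp add: abs_mult mult_right_mono)
  qed (use assms in auto)
  then show ?thesis by (simp add: fejer_eq sum_divide_distrib)
qed

text \<open>Multiplying a density with Fourier coefficients \<open>a\<close> by \<open>fejer m (q x)\<close> replaces \<open>a\<close> by \<open>fejer_conv a m q\<close>.\<close>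

definition fejer_conv :: "(int \<Rightarrow> real) \<Rightarrow> nat \<Rightarrow> int \<Rightarrow> int \<Rightarrow> real" where
  "fejer_conv a m q h = (\<Sum>r<m. \<Sum>s<m. a (h - (int r - int s) * q)) / real m"

lemma sum_at_most_one:
  fixes f :: "'a \<Rightarrow> real"
  assumes "finite A" "\<And>x. x \<in> A \<Longrightarrow> f x \<le> 1"
    and "\<And>x y. x \<in> A \<Longrightarrow> y \<in> A \<Longrightarrow> f x \<noteq> 0 \<Longrightarrow> f y \<noteq> 0 \<Longrightarrow> x = y"
  shows "sum f A \<le> 1"
proof (cases "\<exists>x\<in>A. f x \<noteq> 0")
  case True
  then obtain x where x: "x \<in> A" "f x \<noteq> 0" by auto
  have "sum f A = f x + sum f (A - {x})" using assms(1) x(1) by (rule sum.remove)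
  also have "sum f (A - {x}) = 0"
    using assms(3)[OF x(1) _ x(2)] by (intro sum.neutral ballI) blast
  finally show ?thesis using assms(2) x by simp
qed (simp add: sum.neutral)

text \<open>The invariant of the coefficients of each density. Nonnegativity allows terms to be
  dropped in lower bounds, \<open>a_0\<close> expresses total mass 1, and the band \<open>D\<close>
  keeps translates by multiples of a large \<open>q\<close> disjoint.\<close>

locale band_limited =
  fixes a :: "int \<Rightarrow> real" and D :: int
  assumes a_nonneg: "0 \<le> a h" and a_le_1: "a h \<le> 1" and a_0: "a 0 = 1"
    and a_band: "\<bar>h\<bar> > D \<Longrightarrow> a h = 0"
begin

lemma fejer_conv_nonneg: "0 \<le> fejer_conv a m q h"
  unfolding fejer_conv_def by (intro divide_nonneg_nonneg sum_nonneg a_nonneg) auto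

lemma shift_unique:
  fixes i j q :: int
  assumes "2 * D < q" "a (h - i * q) \<noteq> 0" "a (h - j * q) \<noteq> 0"
  shows "i = j"
proof (rule ccontr)
  assume "i \<noteq> j"
  have "\<bar>h - i * q\<bar> \<le> D" "\<bar>h - j * q\<bar> \<le> D" using assms a_band by (meson not_le)+
  then have "\<bar>(i - j) * q\<bar> \<le> 2 * D" by (simp add: left_diff_distrib)
  moreover have "1 * \<bar>q\<bar> \<le> \<bar>i - j\<bar> * \<bar>q\<bar>" using \<open>i \<noteq> j\<close> by (intro mult_right_mono) auto
  ultimately show False using assms(1) by (simp add: abs_mult)
qed

text \<open>For each fixed \<open>r\<close>, disjointness of the translates leaves at most one
  nonzero term in the sum over \<open>s\<close>; there are \<open>m\<close> values of
  \<open>r\<close>.\<close>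

lemma fejer_conv_le_1:
  assumes "2 * D < q" "m > 0"
  shows "fejer_conv a m q h \<le> 1"
proof -
  have "(\<Sum>r<m. \<Sum>s<m. a (h - (int r - int s) * q)) \<le> (\<Sum>r<m. 1)"
  proof (intro sum_mono sum_at_most_one a_le_1)
    fix r x y
    assume "a (h - (int r - int x) * q) \<noteq> 0" "a (h - (int r - int y) * q) \<noteq> 0"
    from shift_unique[OF assms(1) this] show "x = y" by simp
  qed simp
  then show ?thesis using assms by (simp add: fejer_conv_def)
qed

text \<open>A shift by a nonzero multiple of \<open>q\<close> pushes \<open>h\<close> out of the
  band, so only the \<open>m\<close> diagonal terms survive, each equal to
  \<open>a h\<close>.\<close>

lemma fejer_conv_low:
  assumes "\<bar>h\<bar> + D < q" "m > 0"
  shows "fejer_conv a m q h = a h"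
proof -
  have "a (h - (int r - int s) * q) = (if r = s then a h else 0)" for r s
  proof (cases "r = s")
    case False
    then have "1 * \<bar>q\<bar> \<le> \<bar>int r - int s\<bar> * \<bar>q\<bar>" by (intro mult_right_mono) auto
    then have "\<bar>h - (int r - int s) * q\<bar> > D" using assms by (simp add: abs_mult[symmetric])
    then show ?thesis using False a_band by simp
  qed simp
  then show ?thesis using assms by (simp add: fejer_conv_def sum.delta')
qed

text \<open>A nonzero term puts \<open>h\<close> within \<open>D\<close> of a multiple
  \<open>(r - s) * q\<close> with \<open>\<bar>r - s\<bar> < m\<close>; if \<open>h\<close> lies
  outside the old band, this multiple is not 0. New frequencies therefore occupy only the range from
  about \<open>q\<close> to about \<open>m * q\<close>.\<close>

lemma fejer_conv_band:
  assumes "fejer_conv a m q h \<noteq> 0" "q \<ge> 0"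
  shows "\<bar>h\<bar> \<le> int m * q + D" and "\<bar>h\<bar> > D \<Longrightarrow> q \<le> \<bar>h\<bar> + D"
proof -
  have "(\<Sum>r<m. \<Sum>s<m. a (h - (int r - int s) * q)) \<noteq> 0"
    using assms(1) by (auto simp: fejer_conv_def)
  then obtain r where r: "r < m" "(\<Sum>s<m. a (h - (int r - int s) * q)) \<noteq> 0"
    by (auto elim: sum.not_neutral_contains_not_neutral)
  then obtain s where s: "s < m" "a (h - (int r - int s) * q) \<noteq> 0"
    by (auto elim: sum.not_neutral_contains_not_neutral)
  then have le: "\<bar>h - (int r - int s) * q\<bar> \<le> D" using a_band by (meson not_le)
  have "\<bar>int r - int s\<bar> * q \<le> int m * q"
    using r s assms by (intro mult_right_mono) auto
  then show "\<bar>h\<bar> \<le> int m * q + D" using le assms(2) abs_mult[of "int r - int s" q] by auto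
  assume h: "\<bar>h\<bar> > D"
  then have "int r - int s \<noteq> 0" using le by auto
  then have "1 * q \<le> \<bar>int r - int s\<bar> * q" using assms(2) by (intro mult_right_mono) auto
  then show "q \<le> \<bar>h\<bar> + D" using le assms(2) abs_mult[of "int r - int s" q] by auto
qed

text \<open>The \<open>m - j\<close> pairs with \<open>r - s = j\<close> each contribute
  \<open>a 0 = 1\<close>; all other terms are nonnegative.\<close>

lemma fejer_conv_ge:
  assumes "j < m"
  shows "fejer_conv a m q (int j * q) \<ge> 1 - real j / real m"
proof -
  have "(\<Sum>s<m - j. 1) \<le> (\<Sum>s<m - j. a (int j * q - (int (s + j) - int s) * q))"
    by (intro sum_mono) (simp add: a_0)
  also have "\<dots> \<le> (\<Sum>s<m - j. \<Sum>r<m. a (int j * q - (int r - int s) * q))"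
    by (intro sum_mono member_le_sum) (auto intro: a_nonneg)
  also have "\<dots> \<le> (\<Sum>s<m. \<Sum>r<m. a (int j * q - (int r - int s) * q))"
    by (intro sum_mono2 sum_nonneg) (auto intro: a_nonneg)
  also have "\<dots> = (\<Sum>r<m. \<Sum>s<m. a (int j * q - (int r - int s) * q))"
    by (rule sum.swap)
  finally have "real m - real j \<le> (\<Sum>r<m. \<Sum>s<m. a (int j * q - (int r - int s) * q))"
    using assms by (simp add: of_nat_diff)
  then have "(real m - real j) / real m \<le> fejer_conv a m q (int j * q)"
    unfolding fejer_conv_def by (rule divide_right_mono) simp
  then show ?thesis using assms by (simp add: diff_divide_distrib)
qed

end

lemma integral_fejer:
  assumes f: "trig D (\<lambda>x. of_real (f x))"
    and a: "\<And>h. (LINT x|U. of_real (f x) * ee (- h) x) = of_real (a h)"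
  shows "(LINT x|U. of_real (f x * fejer m (of_int q * x)) * ee (- h) x) = of_real (fejer_conv a m q h)"
proof -
  have int: "integrable U (\<lambda>x. of_real (f x) * ee k x)" for k
  proof -
    have "trig (D + \<bar>k\<bar>) (\<lambda>x. of_real (f x) * (1 * ee k x))"
      by (intro trig_mult_monom f) auto
    then show ?thesis using trig_integrable[OF _ prob_space_U sets_U] by simp
  qed
  have "(LINT x|U. of_real (f x * fejer m (of_int q * x)) * ee (- h) x)
      = (LINT x|U. (\<Sum>r<m. \<Sum>s<m. of_real (f x) * ee (- (h - (int r - int s) * q)) x) / of_nat m)"
  proof (rule Bochner_Integration.integral_cong)
    fix x
    have "of_real (f x * fejer m (of_int q * x)) * ee (- h) x
        = (\<Sum>r<m. \<Sum>s<m. of_real (f x) * (ee ((int r - int s) * q) x * ee (- h) x)) / of_nat m"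
      unfolding of_real_mult fejer_eq by (simp add: sum_distrib_left sum_distrib_right mult_ac)
    then show "of_real (f x * fejer m (of_int q * x)) * ee (- h) x
        = (\<Sum>r<m. \<Sum>s<m. of_real (f x) * ee (- (h - (int r - int s) * q)) x) / of_nat m"
      by (simp add: ee_mult)
  qed simp
  also have "\<dots> = (\<Sum>r<m. \<Sum>s<m. of_real (a (h - (int r - int s) * q))) / of_nat m"
    using int by (simp add: a del: minus_diff_eq)
  finally show ?thesis by (simp add: fejer_conv_def)
qed

section \<open>Parameters, densities and coefficients of the construction\<close>

definition expo :: "nat \<Rightarrow> nat" where "expo t = 100 ^ t"
definition base :: "nat \<Rightarrow> int" where "base t = 2 ^ expo t"
text \<open>The kernel order is the square of \<open>bound t\<close>, so multiples of the base
  frequency up to \<open>bound t\<close> keep coefficients of at least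
  \<open>1 - 1 / bound t\<close>.\<close>

definition width :: "nat \<Rightarrow> nat" where "width t = 2 ^ (80 * expo t)"
definition bound :: "nat \<Rightarrow> nat" where "bound t = 2 ^ (40 * expo t)"
definition block :: "nat \<Rightarrow> nat set" where "block i = {2 ^ i..<2 ^ Suc i}"
text \<open>One eighth of \<open>base (2 ^ i)\<close>, the first base frequency of block
  \<open>i\<close>; it bounds the degree reached before that block is used. Since
  \<open>expo (2 ^ i) \<ge> 100\<close>, the subtraction does not truncate.\<close>

definition deg :: "nat \<Rightarrow> int" where "deg i = 2 ^ (expo (2 ^ i) - 3)"

primrec dens :: "nat \<Rightarrow> real \<Rightarrow> real" where
  "dens 0 = (\<lambda>x. 1)"
| "dens (Suc i) = (\<lambda>x. (\<Sum>t\<in>block i. dens i x * fejer (width t) (of_int (base t) * x)) / 2 ^ i)"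

text \<open>Real numbers following the recursion of \<open>dens\<close> on the Fourier side;
  \<open>integral_dens\<close> identifies them as its coefficients.\<close>

primrec coef :: "nat \<Rightarrow> int \<Rightarrow> real" where
  "coef 0 = (\<lambda>h. if h = 0 then 1 else 0)"
| "coef (Suc i) = (\<lambda>h. (\<Sum>t\<in>block i. fejer_conv (coef i) (width t) (base t) h) / 2 ^ i)"

lemma card_block: "card (block i) = 2 ^ i"
  by (simp add: block_def)

lemma finite_block [simp]: "finite (block i)"
  by (simp add: block_def)

lemma base_pos [simp]: "base t > 0"
  by (simp add: base_def)

lemma width_pos [simp]: "width t > 0"
  by (simp add: width_def)

lemma dens_nonneg: "0 \<le> dens i x"
  by (induction i) (auto intro!: sum_nonneg divide_nonneg_nonneg mult_nonneg_nonneg fejer_nonneg)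

lemma trig_scale: "trig D f \<Longrightarrow> trig D (\<lambda>x. c * f x)"
  using trig_mult[of D f 0 "\<lambda>_. c"] trig_const[of 0 c] by simp

lemma trig_dens_fejer:
  assumes "trig D (\<lambda>x. of_real (dens i x))"
  shows "trig (D + int (width t) * base t) (\<lambda>x. of_real (dens i x * fejer (width t) (of_int (base t) * x)))"
  using trig_mult[OF trig_fejer[of "base t" "width t"] assms] by (simp add: less_imp_le)

lemma trig_dens: "\<exists>D. trig D (\<lambda>x. of_real (dens i x))"
proof (induction i)
  case 0
  then show ?case using trig_const[of 0 1] by auto
next
  case (Suc i)
  then obtain D where D: "trig D (\<lambda>x. of_real (dens i x))" by auto
  define D' where "D' = (\<Sum>t\<in>block i. D + int (width t) * base t)"
  have nn: "0 \<le> D + int (width t) * base t" for t using trig_nonneg[OF D] by (simp add: less_imp_le)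
  have "trig D' (\<lambda>x. of_real (1 / 2 ^ i) * (\<Sum>t\<in>block i. of_real (dens i x * fejer (width t) (of_int (base t) * x))))"
  proof (intro trig_scale trig_sum)
    show "0 \<le> D'" unfolding D'_def using nn by (intro sum_nonneg)
    fix t assume t: "t \<in> block i"
    show "trig D' (\<lambda>x. of_real (dens i x * fejer (width t) (of_int (base t) * x)))"
      by (rule trig_mono[OF trig_dens_fejer[OF D]])
        (use t nn in \<open>auto simp: D'_def intro!: member_le_sum\<close>)
  qed
  moreover have "of_real (dens (Suc i) x) = of_real (1 / 2 ^ i) * (\<Sum>t\<in>block i. complex_of_real (dens i x * fejer (width t) (of_int (base t) * x)))" for x
    by simp
  ultimately show ?case by (intro exI[of _ D']) (simp only:)
qed

lemma integral_dens: "(LINT x|U. of_real (dens i x) * ee (- h) x) = of_real (coef i h)"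
proof (induction i arbitrary: h)
  case 0
  then show ?case by (simp add: integral_ee)
next
  case (Suc i)
  obtain D where D: "trig D (\<lambda>x. of_real (dens i x))" using trig_dens by auto
  have int: "integrable U (\<lambda>x. of_real (dens i x * fejer (width t) (of_int (base t) * x)) * ee (- h) x)" for t
    using trig_mult_monom[OF trig_dens_fejer[OF D], of "- h" "\<bar>h\<bar>" t 1] trig_integrable[OF _ prob_space_U sets_U]
    by simp
  have "(LINT x|U. of_real (dens (Suc i) x) * ee (- h) x)
     = (LINT x|U. (\<Sum>t\<in>block i. of_real (dens i x * fejer (width t) (of_int (base t) * x)) * ee (- h) x) / 2 ^ i)"
    by (intro Bochner_Integration.integral_cong) (simp_all add: sum_distrib_right)
  also have "\<dots> = (\<Sum>t\<in>block i. of_real (fejer_conv (coef i) (width t) (base t) h)) / 2 ^ i"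
    using int integral_fejer[OF D Suc.IH] by simp
  finally show ?case by simp
qed

lemma expo_mono: "s \<le> t \<Longrightarrow> expo s \<le> expo t"
  unfolding expo_def by (intro power_increasing) auto

lemma expo_step: "s < t \<Longrightarrow> 100 * expo s \<le> expo t"
  using expo_mono[of "Suc s" t] by (simp add: expo_def)

lemma expo_gt: "t < expo t"
  unfolding expo_def by (rule power_gt_expt) simp

lemma expo_ge_100: "t > 0 \<Longrightarrow> expo t \<ge> 100"
  using expo_step[of 0 t] by (simp add: expo_def)

lemma deg_mono: "i \<le> j \<Longrightarrow> deg i \<le> deg j"
  unfolding deg_def by (intro power_increasing diff_le_mono expo_mono power_increasing) auto

lemma deg_pos: "deg i > 0"
  by (simp add: deg_def)

lemma deg_le_base: "2 ^ i \<le> t \<Longrightarrow> 8 * deg i \<le> base t"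
proof -
  assume "2 ^ i \<le> t"
  have "expo (2 ^ i) \<ge> 100" by (rule expo_ge_100) simp
  then have "8 * deg i = 2 ^ expo (2 ^ i)"
    using power_add[of "2::int" 3 "expo (2 ^ i) - 3"] by (simp add: deg_def)
  also have "\<dots> \<le> base t"
    unfolding base_def by (intro power_increasing expo_mono \<open>2 ^ i \<le> t\<close>) auto
  finally show ?thesis .
qed

lemma width_base: "int (width t) * base t = 2 ^ (81 * expo t)"
  by (simp add: width_def base_def flip: power_add)

text \<open>Growth of \<open>expo\<close> by a factor of at least 100 leaves room for the exponent
  \<open>81 * expo t\<close> of the highest frequency, the doubling and the \<open>- 3\<close> in
  \<open>deg\<close>.\<close>

lemma width_base_le_deg: "t < 2 ^ i \<Longrightarrow> 2 * (int (width t) * base t) \<le> deg i"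
proof -
  assume "t < 2 ^ i"
  from expo_step[OF this] have "81 * expo t + 1 \<le> expo (2 ^ i) - 3"
    using expo_gt[of t] by linarith
  then have "(2::int) ^ (81 * expo t + 1) \<le> deg i" unfolding deg_def by (intro power_increasing) auto
  then show ?thesis by (simp add: width_base)
qed

lemma width_base_less_base: "s < t \<Longrightarrow> 2 * (int (width s) * base s) \<le> base t"
proof -
  assume "s < t"
  from expo_step[OF this] have "81 * expo s + 1 \<le> expo t"
    using expo_gt[of s] by linarith
  then have "(2::int) ^ (81 * expo s + 1) \<le> base t" unfolding base_def by (intro power_increasing) auto
  then show ?thesis by (simp add: width_base)
qed

lemma two_deg_le: "2 * deg i \<le> deg (Suc i)"
proof -
  have "8 * deg i \<le> base (2 ^ i)" by (rule deg_le_base) simp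
  also have "base (2 ^ i) \<le> int (width (2 ^ i)) * base (2 ^ i)"
    using mult_right_mono[of 1 "int (width (2 ^ i))" "base (2 ^ i)"]
    by (simp add: Suc_le_eq less_imp_le del: of_nat_0_less_iff of_nat_1)
  finally show ?thesis using width_base_le_deg[of "2 ^ i" "Suc i"] deg_pos[of i] by simp
qed

lemma band_limited_coef: "band_limited (coef i) (deg i)"
proof (induction i)
  case 0
  then show ?case using deg_pos[of 0] by unfold_locales auto
next
  case (Suc i)
  then interpret band_limited "coef i" "deg i" .
  have t: "8 * deg i \<le> base t" if "t \<in> block i" for t
    using that deg_le_base by (simp add: block_def)
  show ?case
  proof
    fix h
    show "0 \<le> coef (Suc i) h" by (auto intro!: sum_nonneg divide_nonneg_nonneg fejer_conv_nonneg)
    have "(\<Sum>t\<in>block i. fejer_conv (coef i) (width t) (base t) h) \<le> (\<Sum>t\<in>block i. 1)"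
      using t deg_pos[of i] by (intro sum_mono fejer_conv_le_1) force+
    then show "coef (Suc i) h \<le> 1" by (simp add: card_block)
    have "(\<Sum>t\<in>block i. fejer_conv (coef i) (width t) (base t) 0) = (\<Sum>t\<in>block i. 1)"
      using t deg_pos[of i] a_0 by (intro sum.cong refl) (subst fejer_conv_low, force+)
    then show "coef (Suc i) 0 = 1" by (simp add: card_block)
    assume h: "\<bar>h\<bar> > deg (Suc i)"
    \<comment> \<open>The new degree is at most \<open>width t * base t + deg i\<close>, and each of
      the two terms is at most half of \<open>deg (Suc i)\<close>.\<close>
    have "fejer_conv (coef i) (width t) (base t) h = 0" if "t \<in> block i" for t
    proof (rule ccontr)
      assume "\<not> ?thesis"
      from fejer_conv_band(1)[OF this] have "\<bar>h\<bar> \<le> int (width t) * base t + deg i"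
        by (simp add: less_imp_le)
      moreover have "2 * (int (width t) * base t) \<le> deg (Suc i)"
        using that by (intro width_base_le_deg) (simp add: block_def)
      ultimately show False using h two_deg_le[of i] by linarith
    qed
    then show "coef (Suc i) h = 0" by simp
  qed
qed

text \<open>All base frequencies of block \<open>i\<close> are at least \<open>8 * deg i\<close>, so
  none of its kernels affects a frequency in the present band. Later stages thus leave settled
  coefficients unchanged.\<close>

lemma coef_Suc_low:
  assumes "\<bar>h\<bar> \<le> deg i"
  shows "coef (Suc i) h = coef i h"
proof -
  interpret band_limited "coef i" "deg i" by (rule band_limited_coef)
  have "(\<Sum>t\<in>block i. fejer_conv (coef i) (width t) (base t) h) = (\<Sum>t\<in>block i. coef i h)"
  proof (intro sum.cong refl fejer_conv_low)
    fix t assume "t \<in> block i"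
    then have "8 * deg i \<le> base t" by (simp add: block_def deg_le_base)
    then show "\<bar>h\<bar> + deg i < base t" using assms deg_pos[of i] by linarith
  qed simp
  then show ?thesis by (simp add: card_block)
qed

lemma coef_stable: "i \<le> n \<Longrightarrow> \<bar>h\<bar> \<le> deg i \<Longrightarrow> coef n h = coef i h"
proof (induction n rule: dec_induct)
  case (step n)
  then have "\<bar>h\<bar> \<le> deg n" using deg_mono[of i n] by linarith
  then show ?case using coef_Suc_low step by metis
qed simp

text \<open>The frequency ranges of different \<open>t\<close> are disjoint, so only one summand contributes.\<close>

lemma coef_Suc_high:
  assumes "\<bar>h\<bar> > deg i"
  shows "coef (Suc i) h \<le> 1 / 2 ^ i"
proof -
  interpret band_limited "coef i" "deg i" by (rule band_limited_coef)
  have t: "8 * deg i \<le> base t" if "t \<in> block i" for t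
    using that by (simp add: block_def deg_le_base)
  have lt: "\<not> s < t" if "s \<in> block i" "t \<in> block i"
    "fejer_conv (coef i) (width s) (base s) h \<noteq> 0" "fejer_conv (coef i) (width t) (base t) h \<noteq> 0" for s t
  proof
    \<comment> \<open>Both terms being nonzero gives
      \<open>base t - deg i \<le> \<bar>h\<bar> \<le> base t / 2 + deg i\<close>, against
      \<open>base t \<ge> 8 * deg i\<close>.\<close>
    assume "s < t"
    have "\<bar>h\<bar> \<le> int (width s) * base s + deg i"
      using fejer_conv_band(1)[OF that(3)] by (simp add: less_imp_le)
    moreover have "base t \<le> \<bar>h\<bar> + deg i"
      using fejer_conv_band(2)[OF that(4)] assms by (simp add: less_imp_le)
    ultimately show False using width_base_less_base[OF \<open>s < t\<close>] t[OF that(2)] deg_pos[of i] by linarith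
  qed
  have "(\<Sum>t\<in>block i. fejer_conv (coef i) (width t) (base t) h) \<le> 1"
  proof (rule sum_at_most_one)
    fix t assume "t \<in> block i"
    then show "fejer_conv (coef i) (width t) (base t) h \<le> 1"
      using t[of t] deg_pos[of i] by (intro fejer_conv_le_1) auto
  next
    fix s t assume "s \<in> block i" "t \<in> block i"
      "fejer_conv (coef i) (width s) (base s) h \<noteq> 0" "fejer_conv (coef i) (width t) (base t) h \<noteq> 0"
    with lt[of s t] lt[of t s] show "s = t" by (meson linorder_neqE_nat)
  qed simp
  then show ?thesis by (simp add: divide_right_mono)
qed

lemma exists_deg_between:
  assumes "h > deg 0"
  obtains i where "deg i < h" "h \<le> deg (Suc i)"
proof -
  have "int i \<le> deg i" for i
  proof (induction i)
    case 0
    show ?case using deg_pos[of 0] by simp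
  next
    case (Suc i)
    then show ?case using two_deg_le[of i] deg_pos[of i] by linarith
  qed
  from this[of "nat h"] have ex: "h \<le> deg (nat h)" by linarith
  define j where "j = (LEAST j. h \<le> deg j)"
  have j: "h \<le> deg j" unfolding j_def using ex by (rule LeastI)
  with assms have "j \<noteq> 0" by (metis leD)
  then obtain i where i: "j = Suc i" by (cases j) auto
  have "\<not> h \<le> deg i"
    using not_less_Least[of i "\<lambda>j. h \<le> deg j"] i j_def by simp
  then show ?thesis using that[of i] j i by simp
qed

text \<open>From \<open>h \<le> 2 ^ expo (2 ^ Suc i)\<close> follows
  \<open>ln (ln h) \<le> 2 ^ Suc i * ln 100\<close>, which turns the factor \<open>1 / 2 ^ i\<close>
  of \<open>coef_Suc_high\<close> into the required rate.\<close>

lemma coef_bound: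
  assumes h: "h > deg i" "h \<le> deg (Suc i)"
  shows "coef (Suc i) h \<le> 2 * ln 100 * (1 / ln (ln (real_of_int h)))"
proof -
  \<comment> \<open>This keeps \<open>h\<close> above \<open>exp 2\<close>, so that the iterated
    logarithm is positive.\<close>
  have "deg i \<ge> 2 ^ 97"
  proof -
    have "expo (2 ^ i) \<ge> 100" by (rule expo_ge_100) simp
    then show ?thesis unfolding deg_def by (intro power_increasing) auto
  qed
  then have h97: "h > 2 ^ 97" using h by linarith
  then have "real_of_int h > of_int (2 ^ 97)" by (simp only: of_int_less_iff)
  then have h9: "real_of_int h > 9" by simp
  have e9: "exp 1 * exp (1::real) < 9"
  proof -
    have "exp (1::real) < 3" using e_less_272 by simp
    then show ?thesis using mult_strict_mono[of "exp 1" "3::real" "exp 1" 3] by simp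
  qed
  have "ln (real_of_int h) > 2"
  proof -
    have "exp (2::real) = exp 1 * exp 1" by (simp flip: exp_add)
    then have "exp 2 < real_of_int h" using h9 e9 by linarith
    then have "ln (exp 2) < ln (real_of_int h)" using h9 by (subst ln_less_cancel_iff) auto
    then show ?thesis by simp
  qed
  then have ll: "ln (ln (real_of_int h)) > 0" and l: "ln (real_of_int h) > 0" by simp_all
  have "real_of_int h \<le> of_int (2 ^ expo (2 ^ Suc i))"
  proof (subst of_int_le_iff)
    have "deg (Suc i) \<le> 2 ^ expo (2 ^ Suc i)"
      unfolding deg_def by (intro power_increasing) auto
    then show "h \<le> 2 ^ expo (2 ^ Suc i)" using h by linarith
  qed
  then have "ln (real_of_int h) \<le> ln (2 ^ expo (2 ^ Suc i))"
    using h9 by (subst ln_le_cancel_iff) auto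
  also have "\<dots> = real (expo (2 ^ Suc i)) * ln 2" by (simp add: ln_realpow)
  also have "\<dots> \<le> real (expo (2 ^ Suc i)) * 1"
    using ln_2_less_1 by (intro mult_left_mono) auto
  finally have "ln (ln (real_of_int h)) \<le> ln (real (expo (2 ^ Suc i)))"
    using l by (subst ln_le_cancel_iff) auto
  also have "\<dots> = 2 ^ Suc i * ln 100" by (simp add: expo_def ln_realpow)
  finally have "1 / (2 ^ Suc i * ln 100) \<le> 1 / ln (ln (real_of_int h))"
    using ll by (intro divide_left_mono mult_pos_pos) auto
  then have "2 * ln 100 * (1 / (2 ^ Suc i * ln 100)) \<le> 2 * ln 100 * (1 / ln (ln (real_of_int h)))"
    by (intro mult_left_mono) auto
  moreover have "2 * ln 100 * (1 / (2 ^ Suc i * ln 100)) = 1 / (2::real) ^ i"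
    by simp
  ultimately show ?thesis using coef_Suc_high[of i h] h deg_pos[of i] by simp
qed

section \<open>Weak limit of the densities\<close>

lemma measurable_dens [measurable]: "dens i \<in> borel_measurable borel"
proof -
  obtain D where "trig D (\<lambda>x. of_real (dens i x))" using trig_dens by auto
  from measurable_compose[OF trig_borel[OF this] borel_measurable_Re] show ?thesis by simp
qed

lemma integrable_dens: "integrable U (dens i)"
proof -
  obtain D where "trig D (\<lambda>x. of_real (dens i x))" using trig_dens by auto
  from integrable_Re[OF trig_integrable[OF this prob_space_U sets_U]] show ?thesis by simp
qed

definition approx :: "nat \<Rightarrow> real measure" where
  "approx n = density U (dens n)"

lemma sets_approx [simp, measurable_cong]: "sets (approx n) = sets borel"
  by (simp add: approx_def)

lemma integral_dens_1: "(LINT x|U. dens n x) = 1"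
proof -
  interpret band_limited "coef n" "deg n" by (rule band_limited_coef)
  have "complex_of_real (LINT x|U. dens n x) = of_real (coef n 0)"
    using integral_dens[of n 0] by simp
  then show ?thesis using a_0 by (simp only: of_real_eq_iff)
qed

lemma real_distribution_approx: "real_distribution (approx n)"
proof -
  have "emeasure (approx n) (space (approx n)) = (\<integral>\<^sup>+x. ennreal (dens n x) \<partial>U)"
    by (simp add: approx_def emeasure_density)
  also have "\<dots> = ennreal (LINT x|U. dens n x)"
    by (rule nn_integral_eq_integral) (auto simp: integrable_dens dens_nonneg)
  finally have "prob_space (approx n)" by (intro prob_spaceI) (simp add: integral_dens_1)
  then show ?thesis by (simp add: real_distribution_def real_distribution_axioms_def)
qed

lemma integral_approx:
  fixes f :: "real \<Rightarrow> complex"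
  assumes "f \<in> borel_measurable borel"
  shows "integral\<^sup>L (approx n) f = (LINT x|U. of_real (dens n x) * f x)"
  unfolding approx_def using assms
  by (subst integral_density) (auto simp: dens_nonneg scaleR_conv_of_real)

lemma tight_approx: "tight approx"
  unfolding tight_def
proof (intro conjI allI impI)
  fix \<epsilon> :: real assume "\<epsilon> > 0"
  \<comment> \<open>\<open>tight\<close> speaks of half-open intervals, so the left end is taken at
    -1 to include all of [0,1].\<close>
  have "measure (approx n) {-1<..1} = 1" for n
  proof -
    interpret real_distribution "approx n" by (rule real_distribution_approx)
    have "AE x in U. x \<in> {0..1}"
      unfolding U_def by (intro AE_uniform_measureI) auto
    then have "AE x in approx n. x \<in> {-1<..1}"
      unfolding approx_def by (subst AE_density) auto
    then show ?thesis by (subst prob_eq_1) auto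
  qed
  then show "\<exists>a b. a < b \<and> (\<forall>n. 1 - \<epsilon> < measure (approx n) {a<..b})"
    using \<open>\<epsilon> > 0\<close> by (intro exI[of _ "-1"] exI[of _ 1]) auto
qed (rule real_distribution_approx)

text \<open>Tightness yields a weakly convergent subsequence, characters are bounded and continuous,
  and each coefficient is eventually constant by \<open>coef_stable\<close>.\<close>

lemma exists_limit_measure:
  obtains \<nu> where "real_distribution \<nu>"
    "\<And>i h. \<bar>h\<bar> \<le> deg i \<Longrightarrow> integral\<^sup>L \<nu> (ee (- h)) = of_real (coef i h)"
proof -
  obtain r \<nu> where r: "strict_mono (r :: nat \<Rightarrow> nat)" and \<nu>: "real_distribution \<nu>"
    and conv: "weak_conv_m (approx \<circ> id \<circ> r) \<nu>"
    using tight_imp_convergent_subsubsequence[OF tight_approx, of id] by (auto simp: strict_mono_id)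
  have "integral\<^sup>L \<nu> (ee (- h)) = of_real (coef i h)" if h: "\<bar>h\<bar> \<le> deg i" for i h
  proof -
    have "(\<lambda>n. integral\<^sup>L ((approx \<circ> id \<circ> r) n) (ee (- h))) \<longlonglongrightarrow> integral\<^sup>L \<nu> (ee (- h))"
    proof (rule weak_conv_imp_integral_bdd_continuous_conv[OF _ \<nu> conv])
      show "real_distribution ((approx \<circ> id \<circ> r) n)" for n by (simp add: real_distribution_approx)
      show "isCont (ee (- h)) x" for x
        using continuous_ee[of UNIV "- h"] by (simp add: continuous_on_eq_continuous_at)
      show "norm (ee (- h) x) \<le> 1" for x by simp
    qed
    moreover have "integral\<^sup>L ((approx \<circ> id \<circ> r) n) (ee (- h)) = of_real (coef i h)" if "n \<ge> i" for n
    proof -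
      have "i \<le> r n" using seq_suble[OF r, of n] that by linarith
      then show ?thesis
        using coef_stable[of i "r n" h] h by (simp add: integral_approx integral_dens)
    qed
    then have "eventually (\<lambda>n. of_real (coef i h) = integral\<^sup>L ((approx \<circ> id \<circ> r) n) (ee (- h))) sequentially"
      unfolding eventually_sequentially by metis
    then have "(\<lambda>n. integral\<^sup>L ((approx \<circ> id \<circ> r) n) (ee (- h))) \<longlonglongrightarrow> of_real (coef i h)"
      by (rule Lim_transform_eventually[OF tendsto_const])
    ultimately show ?thesis by (rule LIMSEQ_unique)
  qed
  with \<nu> that show ?thesis by blast
qed

section \<open>Non-equidistribution\<close>

definition small :: "nat \<Rightarrow> nat set" where
  "small t = {m \<in> S23. m \<le> bound t}"

text \<open>Mean deviation of the points \<open>base t * m * x\<close> from the integers, for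
  \<open>m\<close> in \<open>small t\<close>. Each summand vanishes exactly when its point is an
  integer, and the cosine form makes the mean a trigonometric polynomial in
  \<open>x\<close>.\<close>

definition dev :: "nat \<Rightarrow> real \<Rightarrow> real" where
  "dev t x = (\<Sum>m\<in>small t. 1 - cos (2 * pi * of_int (base t * int m) * x)) / real (card (small t))"

lemma finite_small [simp]: "finite (small t)"
  unfolding small_def by simp

lemma one_in_S23: "1 \<in> S23"
  unfolding S23_def by (auto intro!: exI[of _ 0])

lemma card_small_pos: "card (small t) > 0"
proof -
  have "1 \<in> small t" using one_in_S23 by (simp add: small_def bound_def)
  then show ?thesis using card_gt_0_iff finite_small by blast
qed

lemma dev_nonneg: "0 \<le> dev t x"
  unfolding dev_def by (intro divide_nonneg_nonneg sum_nonneg) auto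

lemma dev_le_2: "dev t x \<le> 2"
proof -
  have "(\<Sum>m\<in>small t. 1 - cos (2 * pi * of_int (base t * int m) * x)) \<le> (\<Sum>m\<in>small t. 2)"
    by (intro sum_mono) (use cos_ge_minus_one in \<open>smt (verit)\<close>)
  then show ?thesis using card_small_pos[of t] by (simp add: dev_def divide_le_eq)
qed

lemma dev_frac: "dev t (frac x) = dev t x"
proof -
  have "cos (2 * pi * of_int k * frac x) = cos (2 * pi * of_int k * x)" for k
    using ee_frac[of k x] by (simp add: ee_def complex_eq_iff)
  then show ?thesis by (simp only: dev_def)
qed

lemma trig_dev: "trig (base t * int (bound t)) (\<lambda>x. of_real (dev t x))"
proof -
  have "trig (base t * int (bound t)) (\<lambda>x. of_real (1 / real (card (small t))) *
      (\<Sum>m\<in>small t. of_real (1 - cos (2 * pi * of_int (base t * int m) * x))))"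
  proof (intro trig_scale trig_sum trig_cos)
    fix m assume "m \<in> small t"
    then show "\<bar>base t * int m\<bar> \<le> base t * int (bound t)"
      by (simp add: small_def abs_mult less_imp_le mult_left_mono)
  qed (simp add: less_imp_le)
  then show ?thesis by (simp add: dev_def)
qed

text \<open>Under the density \<open>dens i x * fejer (width t) (base t * x)\<close> the point \<open>base t * x\<close> is concentrated near the integers.\<close>

lemma integral_dev:
  assumes "t \<in> block i"
  shows "(LINT x|U. dev t x * (dens i x * fejer (width t) (of_int (base t) * x))) \<le> 1 / real (bound t)"
proof -
  interpret band_limited "coef i" "deg i" by (rule band_limited_coef)
  let ?g = "\<lambda>x. dens i x * fejer (width t) (of_int (base t) * x)"
  obtain D where D: "trig D (\<lambda>x. of_real (dens i x))" using trig_dens by auto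
  have int: "integrable U (\<lambda>x. of_real (?g x) * ee (- h) x)" for h
    using trig_mult_monom[OF trig_dens_fejer[OF D], of "- h" "\<bar>h\<bar>" t 1] trig_integrable[OF _ prob_space_U sets_U]
    by simp
  have intg: "integrable U ?g" using integrable_Re[OF int[of 0]] by simp
  have cos_eq: "Re (of_real (?g x) * ee (- h) x) = ?g x * cos (2 * pi * of_int h * x)" for h x
    by (simp add: ee_def)
  have intc: "integrable U (\<lambda>x. ?g x * cos (2 * pi * of_int h * x))" for h
    using integrable_Re[OF int[of h]] unfolding cos_eq .
  have c: "(LINT x|U. ?g x * cos (2 * pi * of_int h * x)) = fejer_conv (coef i) (width t) (base t) h" for h
  proof -
    have "(LINT x|U. ?g x * cos (2 * pi * of_int h * x)) = Re (LINT x|U. of_real (?g x) * ee (- h) x)"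
      unfolding cos_eq[symmetric] by (rule integral_Re[OF int])
    then show ?thesis using integral_fejer[OF D integral_dens] by simp
  qed
  have t: "2 * deg i < base t"
    using deg_le_base[of i t] deg_pos[of i] assms by (simp add: block_def)
  have g_le_1: "(LINT x|U. ?g x) \<le> 1"
    using c[of 0] fejer_conv_le_1[of "base t" "width t" 0] t by simp
  have le: "(LINT x|U. (1 - cos (2 * pi * of_int (base t * int m) * x)) * ?g x) \<le> 1 / real (bound t)"
    if m: "m \<in> small t" for m
  proof -
    \<comment> \<open>With the width equal to this square, the loss \<open>m / width t\<close> in
      \<open>fejer_conv_ge\<close> is at most \<open>1 / bound t\<close> for every
      \<open>m \<le> bound t\<close>.\<close>
    have w: "width t = bound t * bound t"
      by (simp add: width_def bound_def flip: power_add)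
    have "bound t > 1"
      unfolding bound_def using expo_gt[of t] by (intro one_less_power) auto
    moreover have "m \<le> bound t" using m by (simp add: small_def)
    ultimately have b: "m \<le> bound t" "bound t > 1" by auto
    then have "bound t < width t" unfolding w by simp
    then have "fejer_conv (coef i) (width t) (base t) (int m * base t) \<ge> 1 - real m / real (width t)"
      using fejer_conv_ge[of m "width t" "base t"] b by simp
    moreover have "real m / real (width t) \<le> real (bound t) / real (width t)"
      using b by (intro divide_right_mono) auto
    then have "real m / real (width t) \<le> 1 / real (bound t)"
      using b by (simp add: w)
    moreover have "(LINT x|U. (1 - cos (2 * pi * of_int (base t * int m) * x)) * ?g x)
        = (LINT x|U. ?g x) - (LINT x|U. ?g x * cos (2 * pi * of_int (base t * int m) * x))"
      unfolding left_diff_distrib mult_1_left mult.commute[of "cos _"]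
      using intg intc by (rule Bochner_Integration.integral_diff)
    ultimately show ?thesis using g_le_1 by (simp only: c mult.commute[of "base t"])
  qed
  have int1: "integrable U (\<lambda>x. (1 - cos (2 * pi * of_int k * x)) * ?g x)" for k
    unfolding left_diff_distrib mult_1_left mult.commute[of "cos _"]
    using intg intc by (rule Bochner_Integration.integrable_diff)
  have "dev t x * ?g x = (\<Sum>m\<in>small t. (1 - cos (2 * pi * of_int (base t * int m) * x)) * ?g x) / real (card (small t))" for x
    unfolding dev_def by (simp only: times_divide_eq_left sum_distrib_right)
  then have "(LINT x|U. dev t x * ?g x)
      = (\<Sum>m\<in>small t. (LINT x|U. (1 - cos (2 * pi * of_int (base t * int m) * x)) * ?g x)) / real (card (small t))"
    using int1 by (simp only: Bochner_Integration.integral_sum integral_divide_zero)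
  also have "\<dots> \<le> (\<Sum>m\<in>small t. 1 / real (bound t)) / real (card (small t))"
    by (intro divide_right_mono sum_mono le) auto
  also have "\<dots> = 1 / real (bound t)" using card_small_pos[of t] by auto
  finally show ?thesis .
qed

text \<open>A product rather than a minimum, so that the result is again a trigonometric polynomial.\<close>

definition dev_prod :: "nat \<Rightarrow> real \<Rightarrow> real" where
  "dev_prod i x = (\<Prod>t\<in>block i. dev t x)"

lemma dev_prod_nonneg: "0 \<le> dev_prod i x"
  unfolding dev_prod_def by (intro prod_nonneg dev_nonneg)

text \<open>The degrees add up to at most \<open>2 ^ i\<close> times
  \<open>2 ^ (41 * expo l)\<close>, where \<open>l\<close> is the last index of the block, and
  \<open>expo (2 ^ Suc i) = 100 * expo l\<close> leaves room. Within \<open>deg (Suc i)\<close> the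
  limit measure integrates this product exactly as \<open>dens (Suc i)\<close> does.\<close>

lemma trig_dev_prod: "trig (deg (Suc i)) (\<lambda>x. of_real (dev_prod i x))"
proof -
  define l where "l = (2::nat) ^ Suc i - 1"
  have "trig (\<Sum>t\<in>block i. base t * int (bound t)) (\<lambda>x. \<Prod>t\<in>block i. of_real (dev t x))"
    by (intro trig_prod trig_dev) auto
  moreover have "(\<Sum>t\<in>block i. base t * int (bound t)) \<le> deg (Suc i)"
  proof -
    have "(\<Sum>t\<in>block i. base t * int (bound t)) \<le> (\<Sum>t\<in>block i. 2 ^ (41 * expo l))"
    proof (intro sum_mono)
      fix t assume "t \<in> block i"
      then have "t \<le> l" by (auto simp: block_def l_def)
      then have "(2::int) ^ (41 * expo t) \<le> 2 ^ (41 * expo l)"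
        by (intro power_increasing mult_left_mono expo_mono) auto
      then show "base t * int (bound t) \<le> 2 ^ (41 * expo l)"
        by (simp add: base_def bound_def flip: power_add)
    qed
    also have "\<dots> = 2 ^ (i + 41 * expo l)" by (simp add: card_block power_add)
    also have "\<dots> \<le> 2 ^ (expo (2 ^ Suc i) - 3)"
    proof (intro power_increasing)
      have "i < 2 ^ i" by (rule less_exp)
      then have "i \<le> l" unfolding l_def power_Suc by linarith
      also have "l < expo l" by (rule expo_gt)
      finally have "i < expo l" .
      moreover have "100 * expo l \<le> expo (2 ^ Suc i)" by (intro expo_step) (simp add: l_def)
      ultimately show "i + 41 * expo l \<le> expo (2 ^ Suc i) - 3" by linarith
    qed simp
    finally show ?thesis by (simp add: deg_def)
  qed
  ultimately show ?thesis by (simp add: dev_prod_def trig_mono)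
qed

text \<open>\<open>dens (Suc i)\<close> averages over the kernels of the block. In the term of
  \<open>t\<close>, every other factor of the product is at most 2, and \<open>dev t\<close> is
  small against its own kernel.\<close>

lemma integral_dev_prod: "(LINT x|U. dens (Suc i) x * dev_prod i x) \<le> 2 ^ 2 ^ i / 2 ^ (40 * 2 ^ i)"
proof -
  let ?g = "\<lambda>t x. dens i x * fejer (width t) (of_int (base t) * x)"
  obtain D where D: "trig D (\<lambda>x. of_real (dens i x))" using trig_dens by auto
  have int: "integrable U (\<lambda>x. ?g t x * dev_prod i x)" for t
    using integrable_Re[OF trig_integrable[OF trig_mult[OF trig_dev_prod trig_dens_fejer[OF D]] prob_space_U sets_U, of t i]]
    by simp
  have int': "integrable U (\<lambda>x. dev t x * ?g t x)" for t
    using integrable_Re[OF trig_integrable[OF trig_mult[OF trig_dens_fejer[OF D] trig_dev] prob_space_U sets_U, of t t]]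
    by simp
  have le: "(LINT x|U. ?g t x * dev_prod i x) \<le> 2 ^ 2 ^ i / 2 ^ (40 * 2 ^ i)" if t: "t \<in> block i" for t
  proof -
    have prod: "dev_prod i x \<le> 2 ^ 2 ^ i * dev t x" for x
    proof -
      have "(\<Prod>s\<in>block i - {t}. dev s x) \<le> (\<Prod>s\<in>block i - {t}. 2)"
        by (intro prod_mono) (auto simp: dev_nonneg dev_le_2)
      also have "\<dots> = 2 ^ card (block i - {t})" by simp
      also have "\<dots> \<le> 2 ^ card (block i)" by (intro power_increasing card_mono) auto
      finally have "(\<Prod>s\<in>block i - {t}. dev s x) \<le> 2 ^ 2 ^ i" by (simp add: card_block)
      moreover have "dev_prod i x = dev t x * (\<Prod>s\<in>block i - {t}. dev s x)"
        unfolding dev_prod_def using t by (intro prod.remove) auto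
      ultimately show ?thesis
        using dev_nonneg[of t x] by (simp add: mult.commute mult_left_mono)
    qed
    have "(LINT x|U. ?g t x * dev_prod i x) \<le> (LINT x|U. 2 ^ 2 ^ i * (dev t x * ?g t x))"
    proof (rule integral_mono)
      fix x
      have "?g t x * dev_prod i x \<le> ?g t x * (2 ^ 2 ^ i * dev t x)"
        by (intro mult_left_mono prod mult_nonneg_nonneg dens_nonneg fejer_nonneg)
      then show "?g t x * dev_prod i x \<le> 2 ^ 2 ^ i * (dev t x * ?g t x)" by (simp add: mult_ac)
    qed (use int int' in auto)
    also have "\<dots> = 2 ^ 2 ^ i * (LINT x|U. dev t x * ?g t x)" by simp
    also have "\<dots> \<le> 2 ^ 2 ^ i * (1 / real (bound t))"
      by (intro mult_left_mono integral_dev t) auto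
    also have "\<dots> \<le> 2 ^ 2 ^ i * (1 / 2 ^ (40 * 2 ^ i))"
    proof (intro mult_left_mono divide_left_mono)
      have "2 ^ i \<le> t" using t by (simp add: block_def)
      then have "2 ^ i \<le> expo t" using expo_gt[of t] by linarith
      then have "(2::real) ^ (40 * 2 ^ i) \<le> 2 ^ (40 * expo t)" by (intro power_increasing) auto
      then show "2 ^ (40 * 2 ^ i) \<le> real (bound t)" by (simp add: bound_def)
    qed (auto simp: bound_def)
    finally show ?thesis by simp
  qed
  have "(LINT x|U. dens (Suc i) x * dev_prod i x) = (LINT x|U. (\<Sum>t\<in>block i. ?g t x * dev_prod i x) / 2 ^ i)"
    by (simp add: sum_distrib_right)
  also have "\<dots> = (\<Sum>t\<in>block i. (LINT x|U. ?g t x * dev_prod i x)) / 2 ^ i"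
    using int by (simp only: Bochner_Integration.integral_sum integral_divide_zero)
  also have "\<dots> \<le> (\<Sum>t\<in>block i. 2 ^ 2 ^ i / 2 ^ (40 * 2 ^ i)) / 2 ^ i"
    by (intro divide_right_mono sum_mono le) auto
  also have "\<dots> = 2 ^ 2 ^ i / 2 ^ (40 * 2 ^ i)" by (simp add: card_block)
  finally show ?thesis .
qed

text \<open>Both sides are linear in \<open>f\<close> and agree on characters of order at most
  \<open>deg i\<close>.\<close>

lemma integral_limit_trig:
  assumes \<nu>: "real_distribution \<nu>"
    and coef: "\<And>h. \<bar>h\<bar> \<le> deg i \<Longrightarrow> integral\<^sup>L \<nu> (ee (- h)) = of_real (coef i h)"
    and f: "trig (deg i) f"
  shows "integral\<^sup>L \<nu> f = (LINT x|U. of_real (dens i x) * f x)"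
  using f
proof (induction rule: trig.induct)
  case (monom k c)
  then show ?case
    using coef[of "- k"] integral_dens[of i "- k"] by (simp add: mult.left_commute[of _ c])
next
  case (add f g)
  obtain D where D: "trig D (\<lambda>x. of_real (dens i x))" using trig_dens by auto
  have "integrable \<nu> f" "integrable \<nu> g"
    using add.hyps \<nu> by (auto intro!: trig_integrable simp: real_distribution_def real_distribution_axioms_def)
  moreover have "integrable U (\<lambda>x. of_real (dens i x) * f x)" "integrable U (\<lambda>x. of_real (dens i x) * g x)"
    using trig_integrable[OF trig_mult[OF add.hyps(1) D] prob_space_U sets_U]
      trig_integrable[OF trig_mult[OF add.hyps(2) D] prob_space_U sets_U] by auto
  ultimately show ?case using add.IH by (simp add: distrib_left)
qed

text \<open>If \<open>dev t x \<ge> 1/10\<close> throughout block \<open>i\<close>, then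
  \<open>dev_prod i x \<ge> (1/10) ^ 2 ^ i\<close>. By Markov's inequality this has probability at
  most \<open>(2 * 10 / 2 ^ 40) ^ 2 ^ i\<close>, which is summable, so Borel-Cantelli provides a
  good \<open>t\<close> in every late block.\<close>

lemma AE_dev_small:
  assumes \<nu>: "real_distribution \<nu>"
    and coef: "\<And>i h. \<bar>h\<bar> \<le> deg i \<Longrightarrow> integral\<^sup>L \<nu> (ee (- h)) = of_real (coef i h)"
  shows "AE x in \<nu>. \<forall>n. \<exists>t\<ge>n. dev t x < 1 / 10"
proof -
  interpret real_distribution \<nu> by fact
  define A where "A i = {x \<in> space \<nu>. dev_prod i x \<ge> (1 / 10) ^ 2 ^ i}" for i
  have meas: "dev_prod i \<in> borel_measurable \<nu>" for i
    using measurable_compose[OF trig_borel[OF trig_dev_prod[of i]] borel_measurable_Re] by simp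
  have int: "integrable \<nu> (dev_prod i)" for i
    using integrable_Re[OF trig_integrable[OF trig_dev_prod[of i]]] prob_space_axioms by simp
  have A_meas: "A i \<in> events" for i unfolding A_def using meas[of i] by measurable
  have A_le: "measure \<nu> (A i) \<le> (1 / 2) ^ i" for i
  proof -
    have "complex_of_real (LINT x|\<nu>. dev_prod i x) = (LINT x|U. of_real (dens (Suc i) x) * of_real (dev_prod i x))"
      using integral_limit_trig[OF \<nu> coef trig_dev_prod] by simp
    also have "\<dots> = of_real (LINT x|U. dens (Suc i) x * dev_prod i x)"
      unfolding of_real_mult[symmetric] by (rule integral_complex_of_real)
    finally have eq: "(LINT x|\<nu>. dev_prod i x) = (LINT x|U. dens (Suc i) x * dev_prod i x)"
      by (simp only: of_real_eq_iff)
    have "measure \<nu> (A i) \<le> (LINT x|\<nu>. dev_prod i x) / (1 / 10) ^ 2 ^ i"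
      unfolding A_def by (rule integral_Markov_inequality_measure[where A="{}"])
        (auto simp: int dev_prod_nonneg)
    also have "\<dots> \<le> (2 ^ 2 ^ i / 2 ^ (40 * 2 ^ i)) / (1 / 10) ^ 2 ^ i"
      unfolding eq by (intro divide_right_mono integral_dev_prod) auto
    also have "\<dots> = (20 / 2 ^ 40) ^ 2 ^ i"
      by (simp only: power_mult power_divide power_one) (simp flip: power_mult_distrib power_divide)
    also have "\<dots> \<le> (1 / 2) ^ 2 ^ i" by (intro power_mono) auto
    also have "\<dots> \<le> (1 / 2) ^ i"
      by (intro power_decreasing less_imp_le less_exp) auto
    finally show ?thesis .
  qed
  have "AE x in \<nu>. eventually (\<lambda>i. x \<in> space \<nu> - A i) sequentially"
  proof (rule borel_cantelli_AE1)
    show "summable (\<lambda>i. measure \<nu> (A i))"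
      by (rule summable_comparison_test[OF _ summable_geometric[of "1/2"]]) (use A_le in auto)
  qed (use A_meas emeasure_finite in \<open>auto simp: less_top[symmetric]\<close>)
  then show ?thesis
  proof eventually_elim
    case (elim x)
    then have "\<exists>i0. \<forall>i\<ge>i0. dev_prod i x < (1 / 10) ^ 2 ^ i"
      unfolding eventually_sequentially A_def by (auto simp: not_le)
    then obtain i0 where i0: "\<And>i. i \<ge> i0 \<Longrightarrow> dev_prod i x < (1 / 10) ^ 2 ^ i" by auto
    show ?case
    proof
      fix n
      define i where "i = max n i0"
      have "\<exists>t\<in>block i. dev t x < 1 / 10"
      proof (rule ccontr)
        assume "\<not> ?thesis"
        then have "(\<Prod>t\<in>block i. 1 / 10) \<le> dev_prod i x"
          unfolding dev_prod_def by (intro prod_mono) auto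
        then show False using i0[of i] by (simp add: card_block i_def)
      qed
      then obtain t where t: "t \<in> block i" "dev t x < 1 / 10" by auto
      have "n \<le> i" by (simp add: i_def)
      also have "i < 2 ^ i" by (rule less_exp)
      also have "2 ^ i \<le> t" using t by (simp add: block_def)
      finally show "\<exists>t\<ge>n. dev t x < 1 / 10" using t by (auto intro: less_imp_le)
    qed
  qed
qed

section \<open>Counting in S and failure of equidistribution\<close>

lemma card_small_ge: "200 * expo t ^ 2 \<le> card (small t)"
proof -
  let ?f = "\<lambda>(j, k). (2::nat) ^ j * 3 ^ k"
  \<comment> \<open>Bounding 3 by 4, these exponents give at most
    \<open>2 ^ (20 * expo t + 2 * 10 * expo t) = bound t\<close>, and the rectangle has more than
    \<open>200 * expo t ^ 2\<close> points.\<close>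
  have "?f ` ({..20 * expo t} \<times> {..10 * expo t}) \<subseteq> small t"
  proof safe
    fix j k assume jk: "j \<le> 20 * expo t" "k \<le> 10 * expo t"
    have "(2::nat) ^ j * 3 ^ k \<le> 2 ^ j * 4 ^ k" by (intro mult_left_mono power_mono) auto
    also have "\<dots> = 2 ^ (j + 2 * k)" by (simp add: power_add power_mult)
    also have "\<dots> \<le> bound t" unfolding bound_def using jk by (intro power_increasing) auto
    finally show "2 ^ j * 3 ^ k \<in> small t" by (auto simp: small_def S23_def)
  qed
  then have "card (?f ` ({..20 * expo t} \<times> {..10 * expo t})) \<le> card (small t)"
    by (intro card_mono) auto
  moreover have "card (?f ` ({..20 * expo t} \<times> {..10 * expo t})) = (20 * expo t + 1) * (10 * expo t + 1)"
    by (subst card_image) (auto intro!: inj_onI dest: pow23_inj)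
  ultimately show ?thesis by (simp add: algebra_simps power2_eq_square)
qed

text \<open>Without the factor \<open>2 ^ e\<close>, the exponent of 2 is below \<open>e\<close>,
  and that of 3 is at most \<open>41 * e\<close> by size. This strip is small against the
  \<open>200 * e ^ 2\<close> elements provided by \<open>card_small_ge\<close>.\<close>

lemma card_non_multiples:
  "card {s \<in> S23. s \<le> 2 ^ (41 * e) \<and> \<not> (\<exists>m\<in>S23. s = 2 ^ e * m)} \<le> e * (41 * e + 1)" (is "card ?A \<le> _")
proof -
  let ?f = "\<lambda>(j, k). (2::nat) ^ j * 3 ^ k"
  have "?A \<subseteq> ?f ` ({..<e} \<times> {..41 * e})"
  proof safe
    fix s assume s: "s \<in> S23" "s \<le> 2 ^ (41 * e)" "\<not> (\<exists>m\<in>S23. s = 2 ^ e * m)"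
    then obtain j k where jk: "s = 2 ^ j * 3 ^ k" unfolding S23_def by auto
    have "j < e"
    proof (rule ccontr)
      assume "\<not> j < e"
      then have "s = 2 ^ e * (2 ^ (j - e) * 3 ^ k)" using jk by (simp flip: power_add)
      then show False using s(3) unfolding S23_def by blast
    qed
    moreover have "(2::nat) ^ k \<le> 2 ^ (41 * e)"
    proof -
      have "(2::nat) ^ k \<le> 3 ^ k" by (intro power_mono) auto
      also have "\<dots> \<le> s" using jk by simp
      finally show ?thesis using s(2) by linarith
    qed
    then have "k \<le> 41 * e" by simp
    ultimately show "s \<in> ?f ` ({..<e} \<times> {..41 * e})" using jk by force
  qed
  then have "card ?A \<le> card (?f ` ({..<e} \<times> {..41 * e}))" by (intro card_mono) auto
  also have "\<dots> \<le> card ({..<e} \<times> {..41 * e})" by (intro card_image_le) auto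
  finally show ?thesis by simp
qed

text \<open>For a fractional part in the middle half the cosine is at most 0, so each such
  \<open>m\<close> contributes at least 1 to the sum defining \<open>dev\<close>.\<close>

lemma card_bad_small:
  "real (card {m \<in> small t. frac (real (2 ^ expo t * m) * x) \<in> {1/4..<3/4}}) \<le> card (small t) * dev t x"
proof -
  let ?B = "{m \<in> small t. frac (real (2 ^ expo t * m) * x) \<in> {1/4..<3/4}}"
  have "real (card ?B) = (\<Sum>m\<in>?B. 1)" by simp
  also have "\<dots> \<le> (\<Sum>m\<in>?B. 1 - cos (2 * pi * of_int (base t * int m) * x))"
  proof (intro sum_mono)
    fix m assume m: "m \<in> ?B"
    define y where "y = frac (real (2 ^ expo t * m) * x)"
    have y: "1/4 \<le> y" "y \<le> 3/4" using m by (auto simp: y_def)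
    have "cos (2 * pi * of_int (base t * int m) * x) = Re (ee 1 (real (2 ^ expo t * m) * x))"
      by (simp add: ee_def base_def algebra_simps)
    also have "\<dots> = cos (2 * pi * y)"
      unfolding y_def ee_frac[symmetric, of 1 "real (2 ^ expo t * m) * x"] by (simp add: ee_def)
    also have "\<dots> = - cos (2 * pi * y - pi)" by (simp add: cos_diff)
    finally have "cos (2 * pi * of_int (base t * int m) * x) = - cos (2 * pi * y - pi)" .
    moreover have "cos (2 * pi * y - pi) \<ge> 0"
    proof (rule cos_ge_zero)
      have "pi * (1/4) \<le> pi * y" "pi * y \<le> pi * (3/4)" using y by (intro mult_left_mono; simp)+
      then show "- (pi / 2) \<le> 2 * pi * y - pi" "2 * pi * y - pi \<le> pi / 2" by linarith+
    qed
    ultimately show "1 \<le> 1 - cos (2 * pi * of_int (base t * int m) * x)" by linarith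
  qed
  also have "\<dots> \<le> (\<Sum>m\<in>small t. 1 - cos (2 * pi * of_int (base t * int m) * x))"
    by (intro sum_mono2) auto
  also have "\<dots> = card (small t) * dev t x" using card_small_pos[of t] by (simp add: dev_def)
  finally show ?thesis .
qed

text \<open>Up to \<open>2 ^ (41 * expo t)\<close> the elements of \<open>S23\<close> are multiples
  of \<open>2 ^ expo t\<close> by elements of \<open>small t\<close>, apart from at most
  \<open>42 * expo t ^ 2\<close> others. With
  \<open>N \<ge> card (small t) \<ge> 200 * expo t ^ 2\<close>, the share landing in the middle half
  is at most \<open>42/200 + 1/10 < 2/5\<close>. The bound \<open>t \<le> N\<close> makes such
  \<open>N\<close> unbounded.\<close>

lemma freq_dev_small:
  fixes x :: real
  assumes dev: "dev t x < 1 / 10"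
  defines "N \<equiv> card {n. s23 n \<le> 2 ^ (41 * expo t)}"
  shows "t \<le> N" "freq (\<lambda>n. real (s23 n) * x) (1/4) (3/4) N \<le> 2 / 5"
proof -
  define e where "e = expo t"
  have e: "e \<ge> 1" "e > t" using expo_gt[of t] by (auto simp: e_def)
  define X :: nat where "X = 2 ^ (41 * e)"
  define bad where "bad s \<longleftrightarrow> frac (real s * x) \<in> {1/4..<3/4}" for s :: nat
  have N: "N = card {s \<in> S23. s \<le> X}" unfolding N_def X_def e_def by (rule card_S23_below)
  have "small t \<subseteq> {s \<in> S23. s \<le> X}"
  proof -
    have "bound t \<le> X" unfolding bound_def X_def e_def by (intro power_increasing) auto
    then show ?thesis by (auto simp: small_def)
  qed
  then have cN: "card (small t) \<le> N" unfolding N by (intro card_mono) auto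
  have c: "200 * e ^ 2 \<le> card (small t)" unfolding e_def by (rule card_small_ge)
  have "e \<le> 200 * e ^ 2" using e by (simp add: power2_eq_square)
  then show "t \<le> N" using c cN e by linarith
  \<comment> \<open>By monotonicity the indices of the elements up to \<open>X\<close> form an
    initial segment, so counting elements up to \<open>X\<close> is the same as counting among the
    first \<open>N\<close> terms.\<close>
  have seg: "{n. s23 n \<le> X} = {..<N}"
  proof -
    have fin: "finite {n. s23 n \<le> X}"
      using strict_mono_imp_increasing[OF strict_mono_s23] by (auto intro: finite_subset[of _ "{..X}"] order_trans)
    show ?thesis
    proof (cases "{n. s23 n \<le> X} = {}")
      case False
      define k where "k = Max {n. s23 n \<le> X}"
      have "k \<in> {n. s23 n \<le> X}" unfolding k_def using fin False by (rule Max_in)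
      moreover have "n \<le> k" if "s23 n \<le> X" for n unfolding k_def using fin that by (intro Max_ge) auto
      ultimately have "{n. s23 n \<le> X} = {..k}"
        using s23_le_iff by (auto intro: order_trans)
      then show ?thesis unfolding N_def X_def e_def by (simp add: lessThan_Suc_atMost)
    qed (simp add: N_def X_def e_def)
  qed
  have "card {n. n < N \<and> bad (s23 n)} \<le> card {s \<in> S23. s \<le> X \<and> bad s}"
  proof (rule card_inj_on_le)
    show "inj_on s23 {n. n < N \<and> bad (s23 n)}"
      using strict_mono_s23 by (auto intro: inj_on_subset strict_mono_imp_inj_on)
    show "s23 ` {n. n < N \<and> bad (s23 n)} \<subseteq> {s \<in> S23. s \<le> X \<and> bad s}"
      using seg range_s23 by auto
  qed simp
  also have "\<dots> \<le> card ({s \<in> S23. s \<le> 2 ^ (41 * e) \<and> \<not> (\<exists>m\<in>S23. s = 2 ^ e * m)}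
      \<union> (\<lambda>m. 2 ^ e * m) ` {m \<in> small t. bad (2 ^ e * m)})"
  proof (rule card_mono)
    show "{s \<in> S23. s \<le> X \<and> bad s} \<subseteq> {s \<in> S23. s \<le> 2 ^ (41 * e) \<and> \<not> (\<exists>m\<in>S23. s = 2 ^ e * m)}
      \<union> (\<lambda>m. 2 ^ e * m) ` {m \<in> small t. bad (2 ^ e * m)}"
    proof
      fix s assume s: "s \<in> {s \<in> S23. s \<le> X \<and> bad s}"
      have "m \<le> bound t" if "2 ^ e * m \<le> X" for m
      proof -
        have "X = 2 ^ e * bound t" unfolding X_def bound_def e_def by (simp flip: power_add)
        with that show ?thesis by simp
      qed
      then show "s \<in> {s \<in> S23. s \<le> 2 ^ (41 * e) \<and> \<not> (\<exists>m\<in>S23. s = 2 ^ e * m)}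
        \<union> (\<lambda>m. 2 ^ e * m) ` {m \<in> small t. bad (2 ^ e * m)}"
        using s by (cases "\<exists>m\<in>S23. s = 2 ^ e * m") (auto simp: X_def small_def)
    qed
  qed simp
  also have "\<dots> \<le> e * (41 * e + 1) + card {m \<in> small t. bad (2 ^ e * m)}"
    by (intro order_trans[OF card_Un_le] add_mono card_non_multiples card_image_le) auto
  finally have "real (card {n. n < N \<and> bad (s23 n)}) \<le> real (e * (41 * e + 1) + card {m \<in> small t. bad (2 ^ e * m)})"
    by (simp only: of_nat_le_iff)
  also have "\<dots> \<le> real (42 * e ^ 2) + card (small t) * dev t x"
  proof -
    have "e * (41 * e + 1) \<le> 42 * e ^ 2" using e by (simp add: power2_eq_square)
    then have "real (e * (41 * e + 1)) \<le> real (42 * e ^ 2)" by (simp only: of_nat_le_iff)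
    then show ?thesis
      using card_bad_small[of t x] unfolding bad_def e_def by simp
  qed
  also have "\<dots> \<le> real (42 * e ^ 2) + card (small t) * (1 / 10)"
    using dev by (intro add_left_mono mult_left_mono) auto
  also have "\<dots> \<le> 2 / 5 * real N"
  proof -
    have "real (200 * e ^ 2) \<le> card (small t)" "real (card (small t)) \<le> N"
      using c cN by (simp_all only: of_nat_le_iff)
    then show ?thesis by simp
  qed
  finally have "real (card {n. n < N \<and> bad (s23 n)}) \<le> 2 / 5 * real N" .
  moreover have "N > 0" using cN card_small_pos[of t] by linarith
  ultimately show "freq (\<lambda>n. real (s23 n) * x) (1/4) (3/4) N \<le> 2 / 5"
    unfolding bad_def by (simp add: divide_le_eq)
qed

text \<open>The frequency of the middle half would have to tend to \<open>1/2\<close>, but it is at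
  most \<open>2/5\<close> for arbitrarily large \<open>N\<close>.\<close>

lemma not_equidistributed:
  assumes "\<forall>n. \<exists>t\<ge>n. dev t x < 1 / 10"
  shows "\<not> equidistributed_mod1 (\<lambda>n. real (s23 n) * x)"
proof
  assume "equidistributed_mod1 (\<lambda>n. real (s23 n) * x)"
  then have "freq (\<lambda>n. real (s23 n) * x) (1/4) (3/4) \<longlonglongrightarrow> 3/4 - 1/4"
    unfolding equidistributed_mod1_def by (elim allE[of _ "1/4"] allE[of _ "3/4"]) auto
  then have "eventually (\<lambda>N. freq (\<lambda>n. real (s23 n) * x) (1/4) (3/4) N > 2/5) sequentially"
    by (rule order_tendstoD) simp
  then obtain N0 where N0: "\<And>N. N \<ge> N0 \<Longrightarrow> freq (\<lambda>n. real (s23 n) * x) (1/4) (3/4) N > 2/5"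
    unfolding eventually_sequentially by blast
  obtain t where t: "t \<ge> N0" "dev t x < 1 / 10" using assms by auto
  from freq_dev_small[OF t(2)] t(1) N0 show False by (meson leD order_trans)
qed

section \<open>Measurability of the exceptional set\<close>

lemma Rats_between_closed:
  fixes a b :: real
  assumes "0 \<le> a" "a \<le> b" "b \<le> 1" "e > 0"
  obtains a' b' where "a' \<in> \<rat>" "b' \<in> \<rat>" "0 \<le> a'" "a' \<le> a" "b \<le> b'" "b' \<le> 1" "a' < b'" "a - e < a'" "b' < b + e"
proof -
  \<comment> \<open>Equality \<open>a' = a\<close> is tolerated only at the endpoint 0, and
    \<open>b' = b\<close> only at 1; hence \<open>a' < b'\<close> even when
    \<open>a = b\<close>.\<close>
  obtain a' where a': "a' \<in> \<rat>" "0 \<le> a'" "a' \<le> a" "a - e < a'" "a' < a \<or> a = 0"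
  proof (cases "a = 0")
    case False
    then obtain r where "r \<in> \<rat>" "max 0 (a - e) < r" "r < a"
      using Rats_dense_in_real[of "max 0 (a - e)" a] assms by auto
    then show ?thesis using that by auto
  qed (use assms that[of 0] in auto)
  obtain b' where b': "b' \<in> \<rat>" "b' \<le> 1" "b \<le> b'" "b' < b + e" "b < b' \<or> b = 1"
  proof (cases "b = 1")
    case False
    then obtain r where "r \<in> \<rat>" "b < r" "r < min 1 (b + e)"
      using Rats_dense_in_real[of b "min 1 (b + e)"] assms by auto
    then show ?thesis using that by auto
  qed (use assms that[of 1] in auto)
  have "a' < b'" using a' b' assms by linarith
  then show ?thesis using that a' b' by blast
qed

text \<open>Enclosing an interval in a slightly larger rational one gives the upper bound that
  \<open>equidistributed_mod1I\<close> requires. This leaves countably many conditions, hence a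
  Borel set.\<close>

lemma equidistributed_mod1_Rats:
  "equidistributed_mod1 u \<longleftrightarrow>
    (\<forall>a\<in>\<rat>. \<forall>b\<in>\<rat>. 0 \<le> a \<longrightarrow> a < b \<longrightarrow> b \<le> 1 \<longrightarrow> freq u a b \<longlonglongrightarrow> b - a)" (is "_ \<longleftrightarrow> ?R")
proof
  assume R: ?R
  show "equidistributed_mod1 u"
  proof (rule equidistributed_mod1I)
    fix a b e :: real assume ab: "0 \<le> a" "a \<le> b" "b \<le> 1" "e > 0"
    then obtain a' b' where *: "a' \<in> \<rat>" "b' \<in> \<rat>" "0 \<le> a'" "a' \<le> a" "b \<le> b'" "b' \<le> 1" "a' < b'"
      "a - e / 2 < a'" "b' < b + e / 2"
      using Rats_between_closed[of a b "e / 2"] by (metis half_gt_zero)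
    then have "freq u a' b' \<longlonglongrightarrow> b' - a'" using R by blast
    then have "eventually (\<lambda>N. freq u a' b' N < b - a + e) sequentially"
      by (rule order_tendstoD) (use * in linarith)
    then show "eventually (\<lambda>N. freq u a b N \<le> b - a + e) sequentially"
    proof eventually_elim
      case (elim N)
      have "card {n. n < N \<and> frac (u n) \<in> {a..<b}} \<le> card {n. n < N \<and> frac (u n) \<in> {a'..<b'}}"
        using * by (intro card_mono) auto
      then have "freq u a b N \<le> freq u a' b' N" by (intro divide_right_mono) auto
      with elim show ?case by linarith
    qed
  qed
qed (auto simp: equidistributed_mod1_def)

text \<open>Convergence is rewritten with quantifiers over natural numbers only, a countable
  combination of measurable conditions.\<close>

lemma sets_Collect_tendsto:
  fixes f :: "nat \<Rightarrow> 'a \<Rightarrow> real"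
  assumes [measurable]: "\<And>n. f n \<in> borel_measurable M"
  shows "{x \<in> space M. (\<lambda>n. f n x) \<longlonglongrightarrow> c} \<in> sets M"
proof -
  have "(\<lambda>n. f n x) \<longlonglongrightarrow> c \<longleftrightarrow> (\<forall>k. \<exists>n0. \<forall>n\<ge>n0. \<bar>f n x - c\<bar> < inverse (real (Suc k)))" (is "?L \<longleftrightarrow> ?R") for x
  proof
    assume L: ?L
    show ?R using LIMSEQ_D[OF L] by simp
  next
    assume R: ?R
    show ?L
    proof (rule LIMSEQ_I)
      fix r :: real assume "r > 0"
      then obtain k where k: "inverse (real (Suc k)) < r" using reals_Archimedean by blast
      obtain n0 where "\<forall>n\<ge>n0. \<bar>f n x - c\<bar> < inverse (real (Suc k))" using R by blast
      then show "\<exists>no. \<forall>n\<ge>no. norm (f n x - c) < r"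
        using k unfolding real_norm_def by (meson order_less_trans)
    qed
  qed
  then show ?thesis by simp
qed

lemma sets_W23: "W23 \<in> sets (restrict_space borel torus)"
proof -
  have meas: "(\<lambda>x. freq (\<lambda>n. real (s23 n) * x) a b N) \<in> borel_measurable borel" for a b N
  proof -
    have "freq (\<lambda>n. real (s23 n) * x) a b N = (\<Sum>n<N. indicator {a..<b} (frac (real (s23 n) * x))) / real N" for x
    proof -
      have "{n. n < N \<and> frac (real (s23 n) * x) \<in> {a..<b}} = {..<N} \<inter> {n. frac (real (s23 n) * x) \<in> {a..<b}}" by auto
      then show ?thesis by (simp add: indicator_def sum.If_cases Int_def)
    qed
    then show ?thesis unfolding frac_def by measurable
  qed
  define A where "A a b = {x. freq (\<lambda>n. real (s23 n) * x) a b \<longlonglongrightarrow> b - a}" for a b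
  have A: "A a b \<in> sets borel" for a b
    using sets_Collect_tendsto[of "\<lambda>N x. freq (\<lambda>n. real (s23 n) * x) a b N" borel "b - a", OF meas]
    unfolding A_def by (simp only: space_borel UNIV_I simp_thms)
  have "(\<Inter>a\<in>\<rat>. \<Inter>b\<in>\<rat>. if 0 \<le> a \<and> a < b \<and> b \<le> 1 then A a b else UNIV) \<in> sets borel"
    using A Rats_infinite by (intro sets.countable_INT'') (auto simp: countable_rat)
  also have "(\<Inter>a\<in>\<rat>. \<Inter>b\<in>\<rat>. if 0 \<le> a \<and> a < b \<and> b \<le> 1 then A a b else UNIV)
    = {x. \<forall>a\<in>\<rat>. \<forall>b\<in>\<rat>. 0 \<le> a \<longrightarrow> a < b \<longrightarrow> b \<le> 1 \<longrightarrow> x \<in> A a b}"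
    by (auto split: if_splits)
  also have "\<dots> = {x. equidistributed_mod1 (\<lambda>n. real (s23 n) * x)}"
    unfolding equidistributed_mod1_Rats A_def by (simp only: mem_Collect_eq)
  finally have "- {x. equidistributed_mod1 (\<lambda>n. real (s23 n) * x)} \<in> sets borel" by auto
  moreover have "W23 = - {x. equidistributed_mod1 (\<lambda>n. real (s23 n) * x)} \<inter> torus"
    by (auto simp: W23_def)
  ultimately show ?thesis by (auto simp: sets_restrict_space)
qed

section \<open>Transfer of the limit measure to the circle\<close>

theorem exists_measure_W23:
  "\<exists>\<mu>. torus_prob_measure \<mu> \<and> measure \<mu> W23 = 1 \<and>
      (\<lambda>h::int. norm (fourier_coeff \<mu> h)) \<in> O[at_top](\<lambda>h. 1 / ln (ln (real_of_int h)))"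
proof -
  obtain \<nu> where \<nu>: "real_distribution \<nu>"
    and coef: "\<And>i h. \<bar>h\<bar> \<le> deg i \<Longrightarrow> integral\<^sup>L \<nu> (ee (- h)) = of_real (coef i h)"
    by (rule exists_limit_measure) (rule that)
  interpret real_distribution \<nu> by fact
  \<comment> \<open>The weak limit is a measure on the real line. \<open>frac\<close> moves it to
    [0,1) without changing the coefficients, since characters are periodic, or the condition on
    \<open>dev\<close>, by \<open>dev_frac\<close>.\<close>
  define \<mu> where "\<mu> = distr \<nu> (restrict_space borel torus) frac"
  have frac_meas: "frac \<in> measurable \<nu> (restrict_space borel torus)"
  proof (rule measurable_restrict_space2)
    show "frac \<in> space \<nu> \<rightarrow> torus" by (auto simp: torus_def frac_lt_1)
    show "frac \<in> borel_measurable \<nu>" unfolding frac_def by measurable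
  qed
  have \<mu>: "torus_prob_measure \<mu>"
    unfolding torus_prob_measure_def \<mu>_def using frac_meas by (auto intro: prob_space_distr)
  have "AE x in \<nu>. \<forall>n. \<exists>t\<ge>n. dev t x < 1 / 10"
    by (rule AE_dev_small[OF \<nu>]) (rule coef)
  then have "AE x in \<nu>. frac x \<in> W23"
  proof eventually_elim
    case (elim x)
    then have "\<forall>n. \<exists>t\<ge>n. dev t (frac x) < 1 / 10" by (simp add: dev_frac)
    from not_equidistributed[OF this] show ?case by (simp add: W23_def torus_def frac_lt_1)
  qed
  then have "measure \<nu> (frac -` W23 \<inter> space \<nu>) = 1"
    using measurable_sets[OF frac_meas sets_W23] by (subst prob_eq_1) auto
  then have "measure \<mu> W23 = 1"
    unfolding \<mu>_def by (simp add: measure_distr frac_meas sets_W23)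
  moreover have fc: "fourier_coeff \<mu> h = integral\<^sup>L \<nu> (ee (- h))" for h
  proof -
    have "fourier_coeff \<mu> h = (LINT x|\<nu>. ee (- h) (frac x))"
      unfolding fourier_coeff_eq \<mu>_def by (intro integral_distr frac_meas measurable_restrict_space1) simp
    then show ?thesis by (simp add: ee_frac)
  qed
  have "norm (fourier_coeff \<mu> h) \<le> 2 * ln 100 * norm (1 / ln (ln (real_of_int h)))" if h: "h > deg 0" for h
  proof -
    \<comment> \<open>\<open>Suc i\<close> is the first stage whose band contains \<open>h\<close>,
      and the coefficient of the limit at \<open>h\<close> is already that of this stage.\<close>
    obtain i where i: "deg i < h" "h \<le> deg (Suc i)" using exists_deg_between[OF h] by blast
    interpret band_limited "coef (Suc i)" "deg (Suc i)" by (rule band_limited_coef)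
    have "norm (fourier_coeff \<mu> h) = coef (Suc i) h"
      using coef[of h "Suc i"] i deg_pos[of i] a_nonneg[of h] by (simp add: fc del: coef.simps)
    also have "\<dots> \<le> 2 * ln 100 * (1 / ln (ln (real_of_int h)))" by (rule coef_bound[OF i])
    also have "\<dots> \<le> 2 * ln 100 * norm (1 / ln (ln (real_of_int h)))"
      unfolding real_norm_def by (intro mult_left_mono abs_ge_self) simp
    finally show ?thesis .
  qed
  then have "(\<lambda>h::int. norm (fourier_coeff \<mu> h)) \<in> O[at_top](\<lambda>h. 1 / ln (ln (real_of_int h)))"
    by (intro bigoI[of _ "2 * ln 100"] eventually_mono[OF eventually_gt_at_top[of "deg 0"]]) simp
  ultimately show ?thesis using \<mu> by blast
qed

theorem theorem2p10:
  "(\<exists>\<mu>. torus_prob_measure \<mu> \<and> measure \<mu> W23 = 1 \<and>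
      (\<lambda>h::int. norm (fourier_coeff \<mu> h)) \<in> O[at_top](\<lambda>h. 1 / ln (ln (real_of_int h)))) \<and>
   (\<forall>\<alpha>::real. \<alpha> > 1 \<longrightarrow>
      \<not> (\<exists>\<mu>. torus_prob_measure \<mu> \<and> measure \<mu> W23 = 1 \<and>
          (\<lambda>h::int. norm (fourier_coeff \<mu> h)) \<in>
            O[at_top](\<lambda>h. 1 / (ln (ln (real_of_int h))) powr \<alpha>)))"
proof (intro conjI allI impI notI)
  fix \<alpha> :: real
  assume "\<alpha> > 1" and "\<exists>\<mu>. torus_prob_measure \<mu> \<and> measure \<mu> W23 = 1 \<and>
          (\<lambda>h::int. norm (fourier_coeff \<mu> h)) \<in>
            O[at_top](\<lambda>h. 1 / (ln (ln (real_of_int h))) powr \<alpha>)"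
  then show False using measure_W23_neq_1 by blast
qed (rule exists_measure_W23)

end
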